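(* Let $d\ge2$ and let $\mathcal D\subset\mathbb R^d$ be a $C^3$, non-empty, open, bounded and strongly convex domain. There is a constant $C\in(0,\infty)$ such that for all $x,x'\in\partial\mathcal D$, all $A\in\mathcal I_x$, $A'\in\mathcal I_{x'}$, setting $\rho_{x,x',A,A'}=|x-x'|+\|A-A'\|$, (i) for all $y,z\in\mathbb R^d$ such that $h_x(A,y)\in\mathcal D$, $h_{x'}(A',y)\in\mathcal D$, $h_x(A,z)\notin\mathcal D$, $h_{x'}(A',z)\notin\mathcal D$, $$\Big||\bar g_x(A,y,z)-\bar g_{x'}(A',y,z)|-|x-x'|\Big|\le C\rho_{x,x',A,A'}\Big(|z|\wedge1+\frac{|y|(|y-z|\wedge1)}{\delta(h_x(A,y))\wedge\delta(h_{x'}(A',y))}\Big),$$ (ii) for all $y,z\in\mathbb R^d$ such that $h_x(A,y)\in\mathcal D$, $h_{x'}(A',y)\in\mathcal D$, $h_x(A,z)\notin\mathcal D$, $h_{x'}(A',z)\in\mathcal D$, $$\Big||\bar g_x(A,y,z)-h_{x'}(A',z)|-|x-x'|\Big|\le C\rho_{x,x',A,A'}\Big(|z|\wedge1+\frac{|y|(|y-z|\wedge1)}{\delta(h_x(A,y))}\Big),$$ (iii) for all $z\in\mathbb R^d$ such that $h_x(A,z)\notin\mathcal D$, $h_{x'}(A',z)\notin\mathcal D$, $$\Big||\bar g_x(A,0,z)-\bar g_{x'}(A',0,z)|-|x-x'|\Big|\le C\rho_{x,x',A,A'},$$ (iv) for all $z\in\mathbb R^d$, $$\Big||\bar g_x(A,0,z)-\bar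 g_{x'}(A',0,z)|-|x-x'|\Big|\le C.$$
   Context: $B_n(u,r)$ is the open Euclidean ball of $\mathbb R^n$, $\mathbf e_1$ the first canonical basis vector of $\mathbb R^d$, $a\wedge b=\min(a,b)$, $\delta(y)=d(y,\partial\mathcal D)$, $\|A\|=\sup_{|u|=1}|Au|$. $\mathbf n_x$ is the inward unit normal at $x\in\partial\mathcal D$; $\mathcal I_x$ is the set of linear isometries $A$ of $\mathbb R^d$ with $A\mathbf e_1=\mathbf n_x$; $h_x(A,u)=x+Au$. "$C^3$, non-empty, open, bounded, strongly convex" means: $\mathcal D$ is non-empty, open, bounded, and there are $\varepsilon_0\in(0,1)$, $\eta>0$ such that for each $x\in\partial\mathcal D$ there are $A\in\mathcal I_x$ and a $C^3$ function $\psi_x:B_{d-1}(0,\varepsilon_0)\to\mathbb R_+$ with $\psi_x(0)=0$, $\nabla\psi_x(0)=0$, $\mathrm{Hess}\,\psi_x(v)\ge\eta I_{d-1}$ and $|D^2\psi_x(v)|+|D^3\psi_x(v)|\le\eta^{-1}$ for all $v$, and $\mathcal D\cap B_d(x,\varepsilon_0)=\{h_x(A,u):u\in B_d(0,\varepsilon_0),\ u_1>\psi_x(u_2,\dots,u_d)\}$. For $y\in\overline{\mathcal D}$, $z\in\mathbb R^d$, with $(y,z]=\{y+\theta(z-y):\theta\in(0,1]\}$: $\Lambda(y,z)=z$ if $z\in\overline{\mathcal D}$; $\Lambda(y,z)$ is the unique point of $(y,z]\cap\partial\mathcal D$ if $z\notin\overline{\mathcal D}$ and $(y,z]\cap\partial\mathcal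 D\ne\emptyset$; $\Lambda(y,z)=y$ otherwise. For $x\in\partial\mathcal D$, $A\in\mathcal I_x$ and $y,z\in\mathbb R^d$ with $h_x(A,y)\in\overline{\mathcal D}$: $\bar g_x(A,y,z)=\Lambda(h_x(A,y),h_x(A,z))$. *)

theory Defs
  imports "HOL-Analysis.Analysis"
begin

text \<open>
  Euclidean space of dimension \<open>d = CARD('n) + 1 \<ge> 2\<close> is split as a first coordinate and the
  remaining \<open>d - 1 = CARD('n) \<ge> 1\<close> ones; the norm of the product type is the Euclidean one.
\<close>

type_synonym 'n espace = "real \<times> (real ^ 'n)"

definition e1 :: "'n::finite espace" where
  "e1 = (1, 0)"

text \<open>
  Inward unit normal to \<open>\<partial>D\<close> at \<open>x\<close>: a unit vector, orthogonal to the tangent space of \<open>\<partial>D\<close> at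
  \<open>x\<close> (that is, \<open>n \<bullet> (y - x) = o(\<bar>y - x\<bar>)\<close> as \<open>y \<rightarrow> x\<close> along \<open>\<partial>D\<close>), and pointing into \<open>D\<close>.
  It is unique as soon as \<open>\<partial>D\<close> is a differentiable hypersurface near \<open>x\<close>.
\<close>

definition inward_normal :: "'a::euclidean_space set \<Rightarrow> 'a \<Rightarrow> 'a" where
  "inward_normal D x = (THE n. norm n = 1
     \<and> ((\<lambda>y. (n \<bullet> (y - x)) / norm (y - x)) \<longlongrightarrow> 0) (at x within frontier D)
     \<and> (\<forall>\<^sub>F t in at_right 0. x + t *\<^sub>R n \<in> D))"

definition normal_isometries ::
    "'n::finite espace set \<Rightarrow> 'n espace \<Rightarrow> ('n espace \<Rightarrow> 'n espace) set" where
  "normal_isometries D x =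
     {A. linear A \<and> (\<forall>u. norm (A u) = norm u) \<and> A e1 = inward_normal D x}"

definition hmap :: "'a::real_vector \<Rightarrow> ('a \<Rightarrow> 'a) \<Rightarrow> 'a \<Rightarrow> 'a" where
  "hmap x A u = x + A u"

text \<open>
  \<open>f\<close> is of class \<open>C\<^sup>3\<close> on the open set \<open>S\<close>, with successive Frechet derivatives \<open>f1\<close>, \<open>f2\<close>, \<open>f3\<close>
  there (continuity of \<open>f\<close>, \<open>f1\<close> and \<open>f2\<close> follows from their differentiability).
\<close>

definition C3_on_with ::
    "'a::real_normed_vector set \<Rightarrow> ('a \<Rightarrow> real) \<Rightarrow> ('a \<Rightarrow> 'a \<Rightarrow>\<^sub>L real)
      \<Rightarrow> ('a \<Rightarrow> 'a \<Rightarrow>\<^sub>L 'a \<Rightarrow>\<^sub>L real) \<Rightarrow> ('a \<Rightarrow> 'a \<Rightarrow>\<^sub>L 'a \<Rightarrow>\<^sub>L 'a \<Rightarrow>\<^sub>L real) \<Rightarrow> bool" where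
  "C3_on_with S f f1 f2 f3 \<longleftrightarrow>
     (\<forall>v\<in>S. (f has_derivative blinfun_apply (f1 v)) (at v)
          \<and> (f1 has_derivative blinfun_apply (f2 v)) (at v)
          \<and> (f2 has_derivative blinfun_apply (f3 v)) (at v))
     \<and> continuous_on S f3"

text \<open>
  The norms of the second and third derivatives below are operator norms; since \<open>\<eta>\<close> is
  existentially quantified, any other choice of norms gives the same notion.
  The condition is local: a disjoint union of two balls satisfies it, and only together with
  connectedness (\<open>D\<close> being a domain) does it make \<open>D\<close> convex.
\<close>

definition C3_strongly_convex :: "'n::finite espace set \<Rightarrow> bool" where
  "C3_strongly_convex D \<longleftrightarrow>
     D \<noteq> {} \<and> open D \<and> bounded D \<and>
     (\<exists>\<epsilon>0 \<eta> :: real. 0 < \<epsilon>0 \<and> \<epsilon>0 < 1 \<and> 0 < \<eta> \<and>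
       (\<forall>x\<in>frontier D. \<exists>A\<in>normal_isometries D x. \<exists>\<psi> \<psi>1 \<psi>2 \<psi>3.
          C3_on_with (ball 0 \<epsilon>0) \<psi> \<psi>1 \<psi>2 \<psi>3
          \<and> (\<forall>v\<in>ball 0 \<epsilon>0. 0 \<le> \<psi> v)
          \<and> \<psi> 0 = 0 \<and> \<psi>1 0 = 0
          \<and> (\<forall>v\<in>ball 0 \<epsilon>0. \<forall>w. \<eta> * (norm w)\<^sup>2 \<le> blinfun_apply (blinfun_apply (\<psi>2 v) w) w)
          \<and> (\<forall>v\<in>ball 0 \<epsilon>0. norm (\<psi>2 v) + norm (\<psi>3 v) \<le> 1 / \<eta>)
          \<and> D \<inter> ball x \<epsilon>0 = {hmap x A u | u. u \<in> ball 0 \<epsilon>0 \<and> fst u > \<psi> (snd u)}))"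

definition ocsegment :: "'a::real_vector \<Rightarrow> 'a \<Rightarrow> 'a set" where
  "ocsegment y z = {y + \<theta> *\<^sub>R (z - y) | \<theta>. 0 < \<theta> \<and> \<theta> \<le> 1}"

definition Lam :: "'a::euclidean_space set \<Rightarrow> 'a \<Rightarrow> 'a \<Rightarrow> 'a" where
  "Lam D y z =
     (if z \<in> closure D then z
      else if ocsegment y z \<inter> frontier D \<noteq> {} then (THE p. p \<in> ocsegment y z \<inter> frontier D)
      else y)"

definition gbar ::
    "'a::euclidean_space set \<Rightarrow> 'a \<Rightarrow> ('a \<Rightarrow> 'a) \<Rightarrow> 'a \<Rightarrow> 'a \<Rightarrow> 'a" where
  "gbar D x A y z = Lam D (hmap x A y) (hmap x A z)"

definition bdist :: "'a::euclidean_space set \<Rightarrow> 'a \<Rightarrow> real" where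
  "bdist D y = infdist y (frontier D)"

definition rho :: "'a::euclidean_space \<Rightarrow> 'a \<Rightarrow> ('a \<Rightarrow> 'a) \<Rightarrow> ('a \<Rightarrow> 'a) \<Rightarrow> real" where
  "rho x x' A A' = norm (x - x') + onorm (\<lambda>u. A u - A' u)"

end

theory Submission
  imports Defs
begin

text \<open>
  Write \<open>h = hmap x A\<close>, \<open>h' = hmap x' A'\<close> and \<open>\<rho> = rho x x' A A'\<close>. In the coordinates given by \<open>h\<close> and
  \<open>h'\<close> one sees two copies of \<open>D\<close>, both containing the origin in their boundary and having \<open>e1\<close> as
  inward normal there. If the segment from \<open>y\<close> to \<open>z\<close> leaves the first copy at \<open>p\<close> and the second one
  at \<open>q\<close>, then \<open>h p - h' q - (x - x') = (A p - A' p) + (A' p - A' q)\<close> has norm at most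
  \<open>\<rho> \<bar>p\<bar> + \<bar>p - q\<bar>\<close> (\<open>displacement_comparison\<close>), so everything rests on a bound for \<open>\<bar>p - q\<bar>\<close>.

  Two facts about the boundary are combined. First, the two copies are close to second order at the
  origin: a boundary point \<open>p\<close> of the first one lies within \<open>K \<rho> \<bar>p\<bar>\<^sup>2\<close> of the boundary of the second
  one (\<open>frontier_near\<close>). Both boundaries are graphs that vanish together with their gradients at the
  origin, and since their Hessians are Lipschitz, these Hessians differ by \<open>O(\<rho>)\<close>. This is where the
  third derivative enters. Second, \<open>D\<close> is globally strongly convex (\<open>strong_support\<close>): at each
  boundary point \<open>b\<close> with inward normal \<open>N\<close>, every \<open>u\<close> in the closure of \<open>D\<close> satisfies
  \<open>(u - b) \<bullet> N \<ge> c \<bar>u - b\<bar>\<^sup>2\<close>. The charts only give this near \<open>b\<close>; it becomes global because a connected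
  open set with these charts is convex (\<open>convex_D\<close>).

  Suppose \<open>p\<close> comes first on the segment, and write \<open>p = (1 - s) y + s q\<close>, \<open>L = \<bar>y - q\<bar>\<close> and \<open>\<delta>\<close> for the
  distance of \<open>h y\<close> to the boundary. By strong convexity the point \<open>h' p\<close> has depth at least of order
  \<open>(1 - s) (\<delta> + s L\<^sup>2)\<close> in \<open>D\<close>, up to an error \<open>O(\<rho> \<bar>y\<bar>\<^sup>2)\<close>, while by proximity its depth is \<open>O(\<rho> \<bar>p\<bar>\<^sup>2)\<close>.
  As \<open>\<bar>p - q\<bar> = (1 - s) L\<close> and \<open>\<bar>p\<bar>\<^sup>2 \<le> 2 \<bar>y\<bar>\<^sup>2 + 2 s L\<^sup>2\<close>, this gives
  \<open>\<bar>p - q\<bar> (\<delta> + c s L\<^sup>2) \<le> C \<rho> L (\<bar>y\<bar>\<^sup>2 + s L\<^sup>2)\<close> (\<open>exit_gap\<close>). The quotient of the two brackets is at most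
  \<open>\<bar>y\<bar>\<^sup>2 / \<delta> + 1 / c\<close>, and \<open>1 / c\<close> if \<open>y = 0\<close>; with \<open>\<delta> \<le> \<bar>y\<bar>\<close> this yields all the estimates
  except the last one, which only expresses that \<open>D\<close> is bounded.
\<close>

\<comment> \<open>Points of the product space are treated as vectors and should not be split into components.\<close>
declare split_paired_All [simp del] split_paired_Ex [simp del]

lemma norm_snd_le_norm: "norm (snd u) \<le> norm u"
  using norm_snd_le[of "snd u" "fst u"] by simp

section \<open>Isometric coordinates\<close>

lemma normal_isometryD:
  assumes "A \<in> normal_isometries D x"
  shows "linear A" "norm (A u) = norm u" "A e1 = inward_normal D x"
  using assms by (auto simp: normal_isometries_def)

lemma normal_isometry_inner:
  assumes "A \<in> normal_isometries D x"
  shows "A u \<bullet> A v = u \<bullet> v"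
proof -
  have "orthogonal_transformation A"
    using assms by (simp add: normal_isometries_def orthogonal_transformation)
  then show ?thesis by (simp add: orthogonal_transformation_def)
qed

lemma inner_e1 [simp]: "e1 \<bullet> u = fst u"
  by (simp add: e1_def inner_prod_def)

lemma inner_inward_normal:
  assumes "A \<in> normal_isometries D x"
  shows "A u \<bullet> inward_normal D x = fst u"
  by (metis assms inner_commute inner_e1 normal_isometryD(3) normal_isometry_inner)

lemma normal_isometry_surj:
  assumes "A \<in> normal_isometries D x"
  shows "surj A"
proof -
  have "inj A"
    using normal_isometryD(1,2)[OF assms] by (metis linear_injective_0 norm_eq_zero)
  then show ?thesis
    using normal_isometryD(1)[OF assms] linear_injective_imp_surjective by blast
qed

lemma obtain_coordinates:
  assumes "A \<in> normal_isometries D x"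
  obtains u where "X = hmap x A u"
  by (metis (no_types, opaque_lifting) add_diff_cancel_left' assms diff_add_cancel hmap_def
      normal_isometry_surj surjD add.commute)

lemma norm_hmap_diff:
  assumes "A \<in> normal_isometries D x"
  shows "norm (hmap x A u - hmap x A v) = norm (u - v)"
  using normal_isometryD[OF assms] by (simp add: hmap_def flip: linear_diff)

lemma hmap_zero [simp]:
  assumes "A \<in> normal_isometries D x"
  shows "hmap x A 0 = x"
  using normal_isometryD(1)[OF assms] by (simp add: hmap_def linear_0)

lemma hmap_convex_comb:
  assumes "A \<in> normal_isometries D x"
  shows "hmap x A ((1 - s) *\<^sub>R u + s *\<^sub>R v) = (1 - s) *\<^sub>R hmap x A u + s *\<^sub>R hmap x A v"
  using normal_isometryD(1)[OF assms]
  by (simp add: hmap_def linear_add linear_scale scaleR_left_diff_distrib scaleR_right_distrib linear_diff)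

lemma rho_bounds:
  assumes "A \<in> normal_isometries D x" "A' \<in> normal_isometries D x'"
  shows "norm (x - x') \<le> rho x x' A A'" "norm (A u - A' u) \<le> rho x x' A A' * norm u"
    "0 \<le> rho x x' A A'"
proof -
  have lin: "bounded_linear (\<lambda>u. A u - A' u)"
    using normal_isometryD(1)[OF assms(1)] normal_isometryD(1)[OF assms(2)]
    by (simp add: bounded_linear_sub linear_conv_bounded_linear)
  have pos: "0 \<le> onorm (\<lambda>u. A u - A' u)" by (rule onorm_pos_le[OF lin])
  then show "norm (x - x') \<le> rho x x' A A'" "0 \<le> rho x x' A A'"
    by (auto simp: rho_def)
  have "norm (A u - A' u) \<le> onorm (\<lambda>u. A u - A' u) * norm u" by (rule onorm[OF lin])
  also have "\<dots> \<le> rho x x' A A' * norm u"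
    by (intro mult_right_mono) (auto simp: rho_def)
  finally show "norm (A u - A' u) \<le> rho x x' A A' * norm u" .
qed

lemma rho_commute: "rho x' x A' A = rho x x' A A'"
  using onorm_neg[of "\<lambda>u. A u - A' u"] by (simp add: rho_def norm_minus_commute)

text \<open>
  Two normal isometries at the same point differ by a rotation that fixes the first axis. This
  transfers information from the isometry of a chart to an arbitrary one.
\<close>
lemma change_of_isometry:
  assumes A: "A \<in> normal_isometries D x" and B: "B \<in> normal_isometries D x"
  obtains u where "B p = A u" "fst u = fst p" "norm u = norm p"
proof -
  obtain u where u: "B p = A u" using normal_isometry_surj[OF A] by (metis surjD)
  moreover have "fst u = fst p"
    using inner_inward_normal[OF A] inner_inward_normal[OF B] u by metis
  moreover have "norm u = norm p"
    using normal_isometryD(2)[OF A] normal_isometryD(2)[OF B] u by metis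
  ultimately show ?thesis using that by blast
qed

section \<open>Boundary charts\<close>

lemma second_order_mean_value:
  fixes f f1 f2 :: "real \<Rightarrow> real"
  assumes "\<And>t. t \<in> {0..1} \<Longrightarrow> (f has_real_derivative f1 t) (at t)"
    and "\<And>t. t \<in> {0..1} \<Longrightarrow> (f1 has_real_derivative f2 t) (at t)"
  obtains t where "0 < t" "t < 1" "f 1 = f 0 + f1 0 + f2 t / 2"
proof -
  define diff where "diff = (\<lambda>m. if m = 0 then f else if m = Suc 0 then f1 else f2)"
  have "\<exists>t>0. t < 1 \<and> f 1 = (\<Sum>m<2. diff m 0 / fact m * 1 ^ m) + diff 2 t / fact 2 * 1 ^ 2"
  proof (rule Maclaurin)
    show "\<forall>m t. m < 2 \<and> 0 \<le> t \<and> t \<le> 1 \<longrightarrow> DERIV (diff m) t :> diff (Suc m) t"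
      using assms by (auto simp: diff_def less_Suc_eq numeral_2_eq_2)
  qed (auto simp: diff_def)
  then show ?thesis
    using that by (auto simp: diff_def numeral_2_eq_2)
qed

text \<open>
  The graph representation of \<open>\<partial>D\<close> near one boundary point \<open>x\<close>, with the constants \<open>\<epsilon>\<close> and \<open>\<eta>\<close>
  that are shared by all boundary points.
\<close>
locale boundary_chart =
  fixes D :: "'n::finite espace set" and \<epsilon> \<eta> :: real and x :: "'n espace"
    and A \<psi> \<psi>1 \<psi>2 \<psi>3
  assumes open_D: "open D"
    and eps: "0 < \<epsilon>" "\<epsilon> < 1" and eta: "0 < \<eta>"
    and A: "A \<in> normal_isometries D x"
    and C3: "C3_on_with (ball 0 \<epsilon>) \<psi> \<psi>1 \<psi>2 \<psi>3"
    and at_zero: "\<psi> 0 = 0" "\<psi>1 0 = 0"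
    and hess_lower: "\<And>v w. v \<in> ball 0 \<epsilon> \<Longrightarrow> \<eta> * (norm w)\<^sup>2 \<le> \<psi>2 v w w"
    and deriv_upper: "\<And>v. v \<in> ball 0 \<epsilon> \<Longrightarrow> norm (\<psi>2 v) + norm (\<psi>3 v) \<le> 1 / \<eta>"
    and graph: "D \<inter> ball x \<epsilon> = {hmap x A u | u. u \<in> ball 0 \<epsilon> \<and> fst u > \<psi> (snd u)}"
begin

lemma has_derivs:
  assumes "v \<in> ball 0 \<epsilon>"
  shows "(\<psi> has_derivative \<psi>1 v) (at v)" "(\<psi>1 has_derivative \<psi>2 v) (at v)"
    "(\<psi>2 has_derivative \<psi>3 v) (at v)"
  using C3 assms by (auto simp: C3_on_with_def)

lemma segment_in_ball:
  assumes "a \<in> ball 0 \<epsilon>" "a + \<alpha> \<in> ball 0 \<epsilon>" "0 \<le> t" "t \<le> 1"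
  shows "a + t *\<^sub>R \<alpha> \<in> ball (0::real^'n) \<epsilon>"
proof -
  have "(1 - t) *\<^sub>R a + t *\<^sub>R (a + \<alpha>) \<in> ball 0 \<epsilon>"
    using assms convexD_alt[OF convex_ball] by blast
  then show ?thesis by (simp add: algebra_simps)
qed

lemma derivs_along_line:
  assumes "a + t *\<^sub>R \<alpha> \<in> ball 0 \<epsilon>"
  shows "((\<lambda>t. \<psi> (a + t *\<^sub>R \<alpha>)) has_real_derivative \<psi>1 (a + t *\<^sub>R \<alpha>) \<alpha>) (at t)"
    "((\<lambda>t. \<psi>1 (a + t *\<^sub>R \<alpha>) \<alpha>) has_real_derivative \<psi>2 (a + t *\<^sub>R \<alpha>) \<alpha> \<alpha>) (at t)"
proof -
  have line: "((\<lambda>t. a + t *\<^sub>R \<alpha>) has_derivative (\<lambda>s. s *\<^sub>R \<alpha>)) (at t)"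
    by (auto intro!: derivative_eq_intros)
  have "((\<lambda>t. \<psi> (a + t *\<^sub>R \<alpha>)) has_derivative (\<lambda>s. \<psi>1 (a + t *\<^sub>R \<alpha>) (s *\<^sub>R \<alpha>))) (at t)"
    using diff_chain_at[OF line has_derivs(1)[OF assms]] by (simp add: o_def)
  then show "((\<lambda>t. \<psi> (a + t *\<^sub>R \<alpha>)) has_real_derivative \<psi>1 (a + t *\<^sub>R \<alpha>) \<alpha>) (at t)"
    unfolding has_field_derivative_def by (simp add: blinfun.scaleR_right mult_commute_abs)
  have "((\<lambda>t. \<psi>1 (a + t *\<^sub>R \<alpha>)) has_derivative (\<lambda>s. \<psi>2 (a + t *\<^sub>R \<alpha>) (s *\<^sub>R \<alpha>))) (at t)"
    using diff_chain_at[OF line has_derivs(2)[OF assms]] by (simp add: o_def)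
  then have "((\<lambda>t. \<psi>1 (a + t *\<^sub>R \<alpha>) \<alpha>) has_derivative (\<lambda>s. \<psi>2 (a + t *\<^sub>R \<alpha>) (s *\<^sub>R \<alpha>) \<alpha>)) (at t)"
    by (auto intro!: derivative_eq_intros)
  then show "((\<lambda>t. \<psi>1 (a + t *\<^sub>R \<alpha>) \<alpha>) has_real_derivative \<psi>2 (a + t *\<^sub>R \<alpha>) \<alpha> \<alpha>) (at t)"
    unfolding has_field_derivative_def
    by (simp add: blinfun.scaleR_right blinfun.scaleR_left mult_commute_abs)
qed

lemma hess_bound:
  assumes "v \<in> ball 0 \<epsilon>"
  shows "\<bar>\<psi>2 v w w'\<bar> \<le> norm w * norm w' / \<eta>"
proof -
  have "\<bar>\<psi>2 v w w'\<bar> \<le> norm (\<psi>2 v w) * norm w'"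
    using norm_blinfun[of "\<psi>2 v w" w'] by simp
  also have "\<dots> \<le> (norm (\<psi>2 v) * norm w) * norm w'"
    by (intro mult_right_mono norm_blinfun) auto
  also have "\<dots> \<le> (1 / \<eta> * norm w) * norm w'"
    using deriv_upper[OF assms] by (intro mult_right_mono) (auto intro: order_trans[rotated])
  finally show ?thesis by simp
qed

lemma quadratic_bounds:
  assumes "v \<in> ball 0 \<epsilon>"
  shows "\<eta> / 2 * (norm v)\<^sup>2 \<le> \<psi> v" "\<psi> v \<le> (norm v)\<^sup>2 / (2 * \<eta>)"
proof -
  have seg: "0 + t *\<^sub>R v \<in> ball 0 \<epsilon>" if "t \<in> {0..1}" for t
    using that assms eps by (intro segment_in_ball) auto
  obtain t where t: "0 < t" "t < 1"
    "\<psi> (0 + 1 *\<^sub>R v) = \<psi> (0 + 0 *\<^sub>R v) + \<psi>1 (0 + 0 *\<^sub>R v) v + \<psi>2 (0 + t *\<^sub>R v) v v / 2"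
    using second_order_mean_value[OF derivs_along_line[OF seg]] by metis
  then have eq: "\<psi> v = \<psi>2 (0 + t *\<^sub>R v) v v / 2"
    using at_zero by simp
  show "\<eta> / 2 * (norm v)\<^sup>2 \<le> \<psi> v"
    using hess_lower[OF seg[of t], of v] t eq by simp
  show "\<psi> v \<le> (norm v)\<^sup>2 / (2 * \<eta>)"
    using hess_bound[OF seg[of t], of v v] t eq by (simp add: power2_eq_square)
qed

lemma grad_bound:
  assumes "v \<in> ball 0 \<epsilon>"
  shows "norm (\<psi>1 v) \<le> norm v / \<eta>"
proof -
  have "norm (\<psi>1 v - \<psi>1 0) \<le> 1 / \<eta> * norm (v - 0)"
  proof (rule differentiable_bound[where S = "ball 0 \<epsilon>" and f' = "\<lambda>v. blinfun_apply (\<psi>2 v)"])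
    fix w :: "real^'n" assume w: "w \<in> ball 0 \<epsilon>"
    show "(\<psi>1 has_derivative \<psi>2 w) (at w within ball 0 \<epsilon>)"
      using has_derivs(2)[OF w] by (rule has_derivative_at_withinI)
    show "onorm (\<psi>2 w) \<le> 1 / \<eta>"
      using deriv_upper[OF w] norm_ge_zero[of "\<psi>3 w"] by (simp add: norm_blinfun.rep_eq del: norm_ge_zero)
  qed (use assms eps in auto)
  then show ?thesis by (simp add: at_zero)
qed

lemma hess_lipschitz:
  assumes "v \<in> ball 0 \<epsilon>" "w \<in> ball 0 \<epsilon>"
  shows "norm (\<psi>2 v - \<psi>2 w) \<le> norm (v - w) / \<eta>"
proof -
  have "norm (\<psi>2 v - \<psi>2 w) \<le> 1 / \<eta> * norm (v - w)"
  proof (rule differentiable_bound[where S = "ball 0 \<epsilon>" and f' = "\<lambda>v. blinfun_apply (\<psi>3 v)"])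
    fix w :: "real^'n" assume w: "w \<in> ball 0 \<epsilon>"
    show "(\<psi>2 has_derivative \<psi>3 w) (at w within ball 0 \<epsilon>)"
      using has_derivs(3)[OF w] by (rule has_derivative_at_withinI)
    show "onorm (\<psi>3 w) \<le> 1 / \<eta>"
      using deriv_upper[OF w] norm_ge_zero[of "\<psi>2 w"] by (simp add: norm_blinfun.rep_eq del: norm_ge_zero)
  qed (use assms eps in auto)
  then show ?thesis by simp
qed

text \<open>
  The second-order Taylor remainders of \<open>\<psi>\<close> at \<open>a\<close> (increment \<open>\<alpha>\<close>) and at \<open>0\<close> (increment \<open>\<beta>\<close>)
  are compared. Each is \<open>O(m\<^sup>2)\<close>; their difference gains the factor \<open>r\<close> because the Hessian is
  Lipschitz. The mean value theorem is applied to the difference along both increments at once,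
  so that both Hessians are taken at the same parameter \<open>t\<close>.
\<close>
lemma taylor_comparison:
  assumes in_ball: "a \<in> ball 0 \<epsilon>" "a + \<alpha> \<in> ball 0 \<epsilon>" "\<beta> \<in> ball 0 \<epsilon>"
    and r: "norm a \<le> r" "norm (\<alpha> - \<beta>) \<le> r * m" and m: "norm \<alpha> \<le> m" "norm \<beta> \<le> m" "m \<le> 1"
  shows "\<bar>(\<psi> (a + \<alpha>) - \<psi> a - \<psi>1 a \<alpha>) - \<psi> \<beta>\<bar> \<le> 2 * r * m\<^sup>2 / \<eta>"
proof -
  define f where "f = (\<lambda>t. (\<psi> (a + t *\<^sub>R \<alpha>) - t * \<psi>1 a \<alpha>) - \<psi> (0 + t *\<^sub>R \<beta>))"
  define f1 where "f1 = (\<lambda>t. (\<psi>1 (a + t *\<^sub>R \<alpha>) \<alpha> - \<psi>1 a \<alpha>) - \<psi>1 (0 + t *\<^sub>R \<beta>) \<beta>)"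
  define f2 where "f2 = (\<lambda>t. \<psi>2 (a + t *\<^sub>R \<alpha>) \<alpha> \<alpha> - \<psi>2 (0 + t *\<^sub>R \<beta>) \<beta> \<beta>)"
  have seg: "a + t *\<^sub>R \<alpha> \<in> ball 0 \<epsilon>" "0 + t *\<^sub>R \<beta> \<in> ball 0 \<epsilon>" if "t \<in> {0..1}" for t
    using that in_ball eps segment_in_ball[of a \<alpha> t] segment_in_ball[of 0 \<beta> t] by auto
  have d: "(f has_real_derivative f1 t) (at t)" "(f1 has_real_derivative f2 t) (at t)"
    if "t \<in> {0..1}" for t
    unfolding f_def f1_def f2_def
    using derivs_along_line[OF seg(1)[OF that]] derivs_along_line[OF seg(2)[OF that]]
    by (auto intro!: derivative_eq_intros)
  obtain t where t: "0 < t" "t < 1" "f 1 = f 0 + f1 0 + f2 t / 2"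
    using second_order_mean_value[OF d] by metis
  have r0: "0 \<le> r" "0 \<le> m" using r(1) m(1) norm_ge_zero order_trans by blast+
  define p where "p = a + t *\<^sub>R \<alpha>"
  define q where "q = 0 + t *\<^sub>R \<beta>"
  have pq: "p \<in> ball 0 \<epsilon>" "q \<in> ball 0 \<epsilon>" using seg t by (auto simp: p_def q_def)
  have "p - q = a + t *\<^sub>R (\<alpha> - \<beta>)" by (simp add: p_def q_def algebra_simps)
  then have "norm (p - q) \<le> norm a + norm (t *\<^sub>R (\<alpha> - \<beta>))"
    by (metis norm_triangle_ineq)
  also have "norm (t *\<^sub>R (\<alpha> - \<beta>)) \<le> 1 * norm (\<alpha> - \<beta>)"
    unfolding norm_scaleR using t by (intro mult_right_mono) auto
  also have "norm a + 1 * norm (\<alpha> - \<beta>) \<le> r + r * 1"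
    using r m(3) r0 mult_left_mono[OF m(3) r0(1)] by simp
  finally have npq: "norm (p - q) \<le> 2 * r" by simp
  have split: "f2 t = (\<psi>2 p - \<psi>2 q) \<alpha> \<alpha> + \<psi>2 q (\<alpha> - \<beta>) \<alpha> + \<psi>2 q \<beta> (\<alpha> - \<beta>)"
    by (simp add: f2_def p_def q_def blinfun.bilinear_simps)
  have "\<bar>(\<psi>2 p - \<psi>2 q) \<alpha> \<alpha>\<bar> \<le> norm ((\<psi>2 p - \<psi>2 q) \<alpha>) * norm \<alpha>"
    using norm_blinfun[of "(\<psi>2 p - \<psi>2 q) \<alpha>" \<alpha>] by simp
  also have "\<dots> \<le> (norm (\<psi>2 p - \<psi>2 q) * norm \<alpha>) * norm \<alpha>"
    by (intro mult_right_mono norm_blinfun) auto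
  also have "\<dots> \<le> (2 * r / \<eta> * m) * m"
    using hess_lipschitz[OF pq] npq eta m r0
    by (intro mult_mono order_trans[OF hess_lipschitz[OF pq]] divide_right_mono) auto
  finally have 1: "\<bar>(\<psi>2 p - \<psi>2 q) \<alpha> \<alpha>\<bar> \<le> 2 * r * m\<^sup>2 / \<eta>" by (simp add: power2_eq_square)
  have "\<bar>\<psi>2 q (\<alpha> - \<beta>) \<alpha>\<bar> \<le> norm (\<alpha> - \<beta>) * norm \<alpha> / \<eta>"
    by (rule hess_bound[OF pq(2)])
  also have "\<dots> \<le> (r * m) * m / \<eta>"
    using r m r0 eta by (intro divide_right_mono mult_mono) auto
  finally have 2: "\<bar>\<psi>2 q (\<alpha> - \<beta>) \<alpha>\<bar> \<le> r * m\<^sup>2 / \<eta>" by (simp add: power2_eq_square)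
  have "\<bar>\<psi>2 q \<beta> (\<alpha> - \<beta>)\<bar> \<le> norm \<beta> * norm (\<alpha> - \<beta>) / \<eta>"
    by (rule hess_bound[OF pq(2)])
  also have "\<dots> \<le> m * (r * m) / \<eta>"
    using r m r0 eta by (intro divide_right_mono mult_mono) auto
  finally have 3: "\<bar>\<psi>2 q \<beta> (\<alpha> - \<beta>)\<bar> \<le> r * m\<^sup>2 / \<eta>" by (simp add: power2_eq_square mult.left_commute)
  have "\<bar>f2 t\<bar> \<le> 4 * (r * m\<^sup>2 / \<eta>)" unfolding split using 1 2 3 by linarith
  moreover have "(\<psi> (a + \<alpha>) - \<psi> a - \<psi>1 a \<alpha>) - \<psi> \<beta> = f2 t / 2"
    using t(3) at_zero by (simp add: f_def f1_def)
  ultimately have "\<bar>(\<psi> (a + \<alpha>) - \<psi> a - \<psi>1 a \<alpha>) - \<psi> \<beta>\<bar> \<le> 2 * (r * m\<^sup>2 / \<eta>)"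
    by linarith
  then show ?thesis by simp
qed

lemma hmap_in_ball_iff: "hmap x A u \<in> ball x \<epsilon> \<longleftrightarrow> u \<in> ball 0 \<epsilon>"
  using norm_hmap_diff[OF A, of u 0] A by (simp add: dist_norm norm_minus_commute)

lemma hmap_inj: "hmap x A u = hmap x A v \<longleftrightarrow> u = v"
  using norm_hmap_diff[OF A, of u v] by auto

lemma mem_D_iff:
  assumes "u \<in> ball 0 \<epsilon>"
  shows "hmap x A u \<in> D \<longleftrightarrow> \<psi> (snd u) < fst u"
proof -
  have "hmap x A u \<in> D \<longleftrightarrow> hmap x A u \<in> D \<inter> ball x \<epsilon>"
    using assms hmap_in_ball_iff by blast
  also have "\<dots> \<longleftrightarrow> \<psi> (snd u) < fst u"
    unfolding graph using assms hmap_inj by auto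
  finally show ?thesis .
qed

lemma snd_in_ball: "u \<in> ball 0 \<epsilon> \<Longrightarrow> snd u \<in> ball 0 \<epsilon>" for u :: "'n espace"
  using norm_snd_le_norm[of u] by simp

text \<open>
  Points of the graph are limits of points slightly above it, which lie in \<open>D\<close>; conversely, a
  limit of points above the graph is not below it, by continuity of \<open>\<psi>\<close>.
\<close>
lemma mem_frontier_iff:
  assumes u: "u \<in> ball 0 \<epsilon>"
  shows "hmap x A u \<in> frontier D \<longleftrightarrow> fst u = \<psi> (snd u)"
proof -
  have lim: "((\<lambda>t. u + t *\<^sub>R e1) \<longlongrightarrow> u) (at_right 0)"
    by (rule tendsto_eq_intros | simp)+
  have limh: "((\<lambda>t. hmap x A (u + t *\<^sub>R e1)) \<longlongrightarrow> hmap x A u) (at_right 0)"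
    unfolding hmap_def
    using linear_continuous_at[OF linear_conv_bounded_linear[THEN iffD1, OF normal_isometryD(1)[OF A]]]
    by (intro tendsto_intros isCont_tendsto_compose[OF _ lim])
  have ev: "\<forall>\<^sub>F t in at_right 0. u + t *\<^sub>R e1 \<in> ball 0 \<epsilon>"
    using u by (intro topological_tendstoD[OF lim]) auto
  have fr: "hmap x A u \<in> frontier D \<longleftrightarrow> hmap x A u \<in> closure D \<and> hmap x A u \<notin> D"
    using open_D by (simp add: frontier_def interior_open)
  show ?thesis
  proof
    assume eq: "fst u = \<psi> (snd u)"
    have "\<forall>\<^sub>F t in at_right 0. hmap x A (u + t *\<^sub>R e1) \<in> closure D"
      using ev eventually_at_right_less[of 0]
    proof eventually_elim
      case (elim t)
      then show ?case
        using mem_D_iff[of "u + t *\<^sub>R e1"] eq closure_subset[of D] by (auto simp: e1_def)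
    qed
    then have "hmap x A u \<in> closure D"
      by (rule Lim_in_closed_set[OF closed_closure _ trivial_limit_at_right_real limh])
    then show "hmap x A u \<in> frontier D"
      using fr mem_D_iff[OF u] eq by simp
  next
    assume "hmap x A u \<in> frontier D"
    then have cl: "hmap x A u \<in> closure D" and "\<not> \<psi> (snd u) < fst u"
      using fr mem_D_iff[OF u] by auto
    moreover have "\<psi> (snd u) \<le> fst u"
    proof -
      obtain X where X: "\<And>n. X n \<in> D" "X \<longlonglongrightarrow> hmap x A u"
        using cl closure_sequential by blast
      have "\<forall>n. \<exists>w. X n = hmap x A w" using obtain_coordinates[OF A] by metis
      then obtain w where w: "\<And>n. X n = hmap x A (w n)" by metis
      have "(\<lambda>n. norm (hmap x A (w n) - hmap x A u)) \<longlonglongrightarrow> 0"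
        using X(2) w by (metis (mono_tags, lifting) LIM_zero tendsto_cong always_eventually tendsto_norm_zero ext)
      then have wl: "w \<longlonglongrightarrow> u"
        unfolding norm_hmap_diff[OF A] using Lim_null tendsto_norm_zero_iff by blast
      have "\<forall>\<^sub>F n in sequentially. w n \<in> ball 0 \<epsilon>"
        using u by (intro topological_tendstoD[OF wl]) auto
      then have "\<forall>\<^sub>F n in sequentially. \<psi> (snd (w n)) \<le> fst (w n)"
        by eventually_elim (metis mem_D_iff X(1) w less_imp_le)
      moreover have "(\<lambda>n. \<psi> (snd (w n))) \<longlonglongrightarrow> \<psi> (snd u)"
        using has_derivative_continuous[OF has_derivs(1)[OF snd_in_ball[OF u]]] tendsto_snd[OF wl]
        by (rule isCont_tendsto_compose)
      ultimately show ?thesis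
        using tendsto_fst[OF wl] by (intro tendsto_le) auto
    qed
    ultimately show "fst u = \<psi> (snd u)" by simp
  qed
qed

text \<open>
  The lower bound on the Hessian controls the tangential part of \<open>u\<close> by its height \<open>fst u\<close>, and
  the normal part of \<open>u\<close> is the height itself, which is below \<open>1\<close>.
\<close>
lemma quadratic_support_local:
  assumes u: "u \<in> ball 0 \<epsilon>" and above: "\<psi> (snd u) \<le> fst u"
  shows "\<eta> * (norm u)\<^sup>2 \<le> (\<eta> + 2) * fst u"
proof -
  have low: "\<eta> / 2 * (norm (snd u))\<^sup>2 \<le> fst u"
    using quadratic_bounds(1)[OF snd_in_ball[OF u]] above by linarith
  then have f0: "0 \<le> fst u"
    using eta by (meson order_trans mult_nonneg_nonneg zero_le_power2 less_imp_le half_gt_zero)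
  have "\<bar>fst u\<bar> < 1" using u eps norm_fst_le[of "fst u" "snd u"] by simp
  then have "(fst u)\<^sup>2 \<le> fst u * 1"
    unfolding power2_eq_square using f0 by (intro mult_left_mono) auto
  moreover have "(norm u)\<^sup>2 = (fst u)\<^sup>2 + (norm (snd u))\<^sup>2"
    by (simp add: norm_prod_def)
  ultimately have "(norm u)\<^sup>2 \<le> fst u + (norm (snd u))\<^sup>2" by simp
  then have "\<eta> * (norm u)\<^sup>2 \<le> \<eta> * (fst u + (norm (snd u))\<^sup>2)"
    using eta by (intro mult_left_mono) auto
  then show ?thesis using low by (simp add: algebra_simps)
qed

lemma graph_point_in_ball:
  assumes "norm v * (1 + 1 / \<eta>) < \<epsilon>"
  shows "v \<in> ball 0 \<epsilon>" "(\<psi> v, v) \<in> ball 0 \<epsilon>"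
proof -
  have "norm v * 1 \<le> norm v * (1 + 1 / \<eta>)" using eta by (intro mult_left_mono) auto
  then show v: "v \<in> ball 0 \<epsilon>" using assms by simp
  have "0 \<le> \<psi> v" using quadratic_bounds(1)[OF v] eta
    by (meson order_trans mult_nonneg_nonneg zero_le_power2 less_imp_le half_gt_zero)
  have "norm (\<psi> v, v) \<le> \<bar>\<psi> v\<bar> + norm v"
    using norm_Pair_le[of "\<psi> v" v] by simp
  also have "\<bar>\<psi> v\<bar> \<le> (norm v)\<^sup>2 / (2 * \<eta>)"
    using quadratic_bounds[OF v] \<open>0 \<le> \<psi> v\<close> by simp
  also have "(norm v)\<^sup>2 / (2 * \<eta>) \<le> norm v / \<eta>"
    using eta eps v mult_right_mono[of "norm v" 2 "norm v"]
    by (simp add: field_simps power2_eq_square)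
  finally have "norm (\<psi> v, v) \<le> norm v * (1 + 1 / \<eta>)" by (simp add: algebra_simps)
  then show "(\<psi> v, v) \<in> ball 0 \<epsilon>" using assms by simp
qed

text \<open>
  Moving vertically onto the graph bounds the distance to \<open>\<partial>D\<close>; the hypothesis keeps the
  resulting graph point inside the chart.
\<close>
lemma frontier_near_graph:
  assumes "norm (snd u) * (1 + 1 / \<eta>) < \<epsilon>"
  obtains b where "b \<in> frontier D" "norm (hmap x A u - b) \<le> \<bar>fst u - \<psi> (snd u)\<bar>"
proof
  let ?v = "(\<psi> (snd u), snd u)"
  show "hmap x A ?v \<in> frontier D"
    using mem_frontier_iff[OF graph_point_in_ball(2)[OF assms]] by simp
  have "u - ?v = (fst u - \<psi> (snd u), 0)" by (simp add: prod_eq_iff)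
  then show "norm (hmap x A u - hmap x A ?v) \<le> \<bar>fst u - \<psi> (snd u)\<bar>"
    unfolding norm_hmap_diff[OF A] by (simp add: norm_Pair)
qed

text \<open>
  The height of a boundary point over the tangent plane at \<open>x\<close> is quadratic, whichever normal
  isometry provides the coordinates.
\<close>
lemma fst_le_of_frontier:
  assumes B: "B \<in> normal_isometries D x" and p: "norm p < \<epsilon>" and fr: "hmap x B p \<in> frontier D"
  shows "0 \<le> fst p" "fst p \<le> (norm p)\<^sup>2 / (2 * \<eta>)"
proof -
  obtain u where u: "B p = A u" "fst u = fst p" "norm u = norm p"
    using change_of_isometry[OF A B] by metis
  have ub: "u \<in> ball 0 \<epsilon>" using u p by simp
  have eq: "fst p = \<psi> (snd u)"
    using fr mem_frontier_iff[OF ub] u by (simp add: hmap_def)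
  have "norm (snd u) \<le> norm p" using norm_snd_le_norm u(3) by metis
  then have "(norm (snd u))\<^sup>2 / (2 * \<eta>) \<le> (norm p)\<^sup>2 / (2 * \<eta>)"
    using eta by (intro divide_right_mono power_mono) auto
  then show "fst p \<le> (norm p)\<^sup>2 / (2 * \<eta>)"
    using quadratic_bounds(2)[OF snd_in_ball[OF ub]] eq by linarith
  show "0 \<le> fst p" using quadratic_bounds(1)[OF snd_in_ball[OF ub]] eq eta
    by (metis order_trans mult_nonneg_nonneg zero_le_power2 less_imp_le half_gt_zero)
qed

text \<open>
  A crude first estimate, from the chart at \<open>x\<close> alone: \<open>\<psi>\<close> is \<open>O(\<bar>p\<bar>\<^sup>2)\<close>, so a point with a
  small normal coordinate is near the boundary.
\<close>
lemma frontier_near_tangential: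
  assumes B: "B \<in> normal_isometries D x" and p: "norm p * (1 + 1 / \<eta>) < \<epsilon>"
  obtains b where "b \<in> frontier D" "norm (hmap x B p - b) \<le> \<bar>fst p\<bar> + (norm p)\<^sup>2 / (2 * \<eta>)"
proof -
  obtain u where u: "B p = A u" "fst u = fst p" "norm u = norm p"
    using change_of_isometry[OF A B] by metis
  have np: "norm (snd u) \<le> norm p" using norm_snd_le_norm u(3) by metis
  then have small: "norm (snd u) * (1 + 1 / \<eta>) < \<epsilon>"
    using p eta by (intro le_less_trans[OF mult_right_mono p]) auto
  obtain b where b: "b \<in> frontier D" "norm (hmap x A u - b) \<le> \<bar>fst u - \<psi> (snd u)\<bar>"
    using frontier_near_graph[OF small] by metis
  have v: "snd u \<in> ball 0 \<epsilon>" by (rule graph_point_in_ball(1)[OF small])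
  have "0 \<le> \<psi> (snd u)" using quadratic_bounds(1)[OF v] eta
    by (meson order_trans mult_nonneg_nonneg zero_le_power2 less_imp_le half_gt_zero)
  moreover have "(norm (snd u))\<^sup>2 / (2 * \<eta>) \<le> (norm p)\<^sup>2 / (2 * \<eta>)"
    using eta np by (intro divide_right_mono power_mono) auto
  ultimately have "\<bar>fst u - \<psi> (snd u)\<bar> \<le> \<bar>fst p\<bar> + (norm p)\<^sup>2 / (2 * \<eta>)"
    using quadratic_bounds(2)[OF v] u by linarith
  then show ?thesis using that b u by (fastforce simp: hmap_def)
qed

text \<open>
  The inward normal at another boundary point \<open>hmap x A a\<close>, written as \<open>\<mu>\<close> in the coordinates of
  the chart at \<open>x\<close>, is a positive multiple of \<open>(1, - \<nabla>\<psi> (snd a))\<close>. It is identified by the half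
  space that it supports: along the graph, \<open>(u - a) \<bullet> \<mu>\<close> has a minimum at \<open>a\<close>, so its derivative
  there vanishes. Normalisation then makes \<open>fst \<mu>\<close> close to \<open>1\<close>, to second order in the
  gradient.
\<close>
lemma normal_in_chart:
  assumes a: "a \<in> ball 0 \<epsilon>" "fst a = \<psi> (snd a)" and \<mu>: "norm \<mu> = 1"
    and supp: "\<And>u. hmap x A u \<in> closure D \<Longrightarrow> 0 \<le> (u - a) \<bullet> \<mu>"
  shows "0 < fst \<mu>" "snd \<mu> \<bullet> w = - fst \<mu> * \<psi>1 (snd a) w"
    "0 \<le> 1 / fst \<mu> - 1" "1 / fst \<mu> - 1 \<le> (norm (\<psi>1 (snd a)))\<^sup>2"
proof -
  have tangent: "snd \<mu> \<bullet> w = - fst \<mu> * \<psi>1 (snd a) w" for w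
  proof -
    define f where "f = (\<lambda>t. fst \<mu> * \<psi> (snd a + t *\<^sub>R w) + t * (snd \<mu> \<bullet> w))"
    have a0: "snd a + 0 *\<^sub>R w \<in> ball 0 \<epsilon>" using snd_in_ball[OF a(1)] by simp
    have der: "(f has_real_derivative (fst \<mu> * \<psi>1 (snd a) w + snd \<mu> \<bullet> w)) (at 0)"
      unfolding f_def using derivs_along_line(1)[OF a0]
      by (auto intro!: derivative_eq_intros)
    have lim: "((\<lambda>t. (\<psi> (snd a + t *\<^sub>R w), snd a + t *\<^sub>R w)) \<longlongrightarrow> a) (at 0)"
    proof -
      have "((\<lambda>t. \<psi> (snd a + t *\<^sub>R w)) \<longlongrightarrow> \<psi> (snd a + 0 *\<^sub>R w)) (at 0)"
        using DERIV_isCont[OF derivs_along_line(1)[OF a0]] unfolding isCont_def .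
      moreover have "((\<lambda>t. snd a + t *\<^sub>R w) \<longlongrightarrow> snd a + 0 *\<^sub>R w) (at 0)"
        by (intro tendsto_intros)
      ultimately have "((\<lambda>t. (\<psi> (snd a + t *\<^sub>R w), snd a + t *\<^sub>R w))
          \<longlongrightarrow> (\<psi> (snd a + 0 *\<^sub>R w), snd a + 0 *\<^sub>R w)) (at 0)"
        by (rule tendsto_Pair)
      moreover have "(\<psi> (snd a + 0 *\<^sub>R w), snd a + 0 *\<^sub>R w) = a"
        using a(2) by (simp add: prod_eq_iff)
      ultimately show ?thesis by simp
    qed
    have "\<forall>\<^sub>F t in at 0. (\<psi> (snd a + t *\<^sub>R w), snd a + t *\<^sub>R w) \<in> ball 0 \<epsilon>"
      using a(1) by (intro topological_tendstoD[OF lim]) auto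
    then obtain d where d: "d > 0"
      "\<And>t. t \<noteq> 0 \<Longrightarrow> dist t 0 < d \<Longrightarrow> (\<psi> (snd a + t *\<^sub>R w), snd a + t *\<^sub>R w) \<in> ball 0 \<epsilon>"
      unfolding eventually_at by auto
    have "f 0 \<le> f t" if "\<bar>0 - t\<bar> < d" for t
    proof (cases "t = 0")
      case False
      let ?u = "(\<psi> (snd a + t *\<^sub>R w), snd a + t *\<^sub>R w)"
      have "?u \<in> ball 0 \<epsilon>" using d(2)[of t] False that by (simp add: dist_real_def)
      then have "hmap x A ?u \<in> closure D"
        using mem_frontier_iff[of ?u] by (simp add: frontier_def)
      then have "0 \<le> (?u - a) \<bullet> \<mu>" by (rule supp)
      then show ?thesis using a(2)
        by (simp add: f_def inner_prod_def algebra_simps inner_commute)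
    qed simp
    then have "fst \<mu> * \<psi>1 (snd a) w + snd \<mu> \<bullet> w = 0"
      using DERIV_local_min[OF der d(1)] by blast
    then show ?thesis by simp
  qed
  then show "snd \<mu> \<bullet> w = - fst \<mu> * \<psi>1 (snd a) w" .
  have norm\<mu>: "(fst \<mu>)\<^sup>2 + (norm (snd \<mu>))\<^sup>2 = 1"
    using \<mu> by (simp add: norm_prod_def real_sqrt_eq_1_iff)
  have "0 \<le> fst \<mu>"
  proof -
    have "((\<lambda>t. a + t *\<^sub>R e1) \<longlongrightarrow> a) (at_right 0)"
      by (rule tendsto_eq_intros | simp)+
    then have "\<forall>\<^sub>F t in at_right 0. a + t *\<^sub>R e1 \<in> ball 0 \<epsilon>"
      using a(1) by (intro topological_tendstoD) auto
    then have "\<forall>\<^sub>F t in at_right 0. a + t *\<^sub>R e1 \<in> ball 0 \<epsilon> \<and> t > (0::real)"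
      using eventually_at_right_less[of "0::real"] by (rule eventually_conj)
    then obtain t :: real where t: "a + t *\<^sub>R e1 \<in> ball 0 \<epsilon>" "t > 0"
      using eventually_happens'[OF trivial_limit_at_right_real] by blast
    have "hmap x A (a + t *\<^sub>R e1) \<in> closure D"
      using mem_D_iff[OF t(1)] t(2) a(2) closure_subset[of D] by (auto simp: e1_def)
    then have "0 \<le> (a + t *\<^sub>R e1 - a) \<bullet> \<mu>" by (rule supp)
    then show ?thesis using t(2) by (simp add: zero_le_mult_iff)
  qed
  moreover have "fst \<mu> \<noteq> 0"
  proof
    assume "fst \<mu> = 0"
    then have "snd \<mu> \<bullet> snd \<mu> = 0" using tangent[of "snd \<mu>"] by simp
    then show False using norm\<mu> \<open>fst \<mu> = 0\<close> by simp
  qed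
  ultimately show pos: "0 < fst \<mu>" by simp
  let ?g = "norm (\<psi>1 (snd a))"
  have "(norm (snd \<mu>))\<^sup>2 = fst \<mu> * (- \<psi>1 (snd a) (snd \<mu>))"
    using tangent[of "snd \<mu>"] by (simp add: power2_norm_eq_inner)
  also have "\<dots> \<le> fst \<mu> * (?g * norm (snd \<mu>))"
    using pos norm_blinfun[of "\<psi>1 (snd a)" "snd \<mu>"] by (intro mult_left_mono) auto
  finally have "norm (snd \<mu>) * norm (snd \<mu>) \<le> (fst \<mu> * ?g) * norm (snd \<mu>)"
    by (simp add: power2_eq_square mult.assoc)
  then have "norm (snd \<mu>) \<le> fst \<mu> * ?g"
    using pos by (cases "norm (snd \<mu>) = 0") auto
  then have "(norm (snd \<mu>))\<^sup>2 \<le> (fst \<mu>)\<^sup>2 * ?g\<^sup>2"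
    using power_mono[of _ _ 2] by (fastforce simp: power_mult_distrib)
  then have "1 \<le> (fst \<mu>)\<^sup>2 * (1 + ?g\<^sup>2)" using norm\<mu> by (simp add: algebra_simps)
  moreover have le1: "fst \<mu> \<le> 1"
  proof -
    have "(fst \<mu>)\<^sup>2 \<le> 1" using norm\<mu> by (metis le_add_same_cancel1 zero_le_power2)
    then show ?thesis using power2_le_imp_le[of "fst \<mu>" 1] by simp
  qed
  moreover have "(fst \<mu>)\<^sup>2 * (1 + ?g\<^sup>2) \<le> fst \<mu> * (1 + ?g\<^sup>2)"
    using le1 pos by (intro mult_right_mono) (auto simp: power2_eq_square mult_le_cancel_left1)
  ultimately show "1 / fst \<mu> - 1 \<le> ?g\<^sup>2" using pos by (simp add: field_simps)
  show "0 \<le> 1 / fst \<mu> - 1" using pos le1 by (simp add: field_simps)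
qed

text \<open>
  All the points involved lie in the chart at \<open>x\<close>, in which \<open>x'\<close> has coordinates \<open>a\<close> and \<open>A' p\<close>,
  \<open>B p\<close> become \<open>\<xi>\<close>, \<open>\<pi>\<close>. The height of \<open>hmap x' A' p\<close> above the graph is the sum of a linear
  term and of a difference of Taylor remainders of \<open>\<psi>\<close>. The remainders are compared by
  \<open>taylor_comparison\<close>. The linear functional \<open>\<xi> \<mapsto> fst \<xi> - \<nabla>\<psi> (snd a) \<bullet> snd \<xi>\<close> is the product
  with the normal \<open>\<mu>\<close> divided by \<open>fst \<mu>\<close>, hence equals \<open>fst p / fst \<mu>\<close>, and it differs from
  \<open>fst p = O(\<bar>p\<bar>\<^sup>2)\<close> by a factor \<open>1 + O(\<rho>)\<close>.
\<close>
lemma frontier_near_local: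
  assumes B: "B \<in> normal_isometries D x" and A': "A' \<in> normal_isometries D x'"
    and x': "x' \<in> frontier D" and supp: "\<And>X. X \<in> closure D \<Longrightarrow> 0 \<le> (X - x') \<bullet> inward_normal D x'"
    and small: "2 * norm p * (1 + 1 / \<eta>) < \<epsilon>" "2 * norm (x - x') * (1 + 1 / \<eta>) < \<epsilon>"
    and fr: "hmap x B p \<in> frontier D"
  obtains b where "b \<in> frontier D"
    "norm (hmap x' A' p - b) \<le> (1 / \<eta> ^ 3 + 2 / \<eta>) * rho x x' B A' * (norm p)\<^sup>2"
proof -
  define \<rho> where "\<rho> = rho x x' B A'"
  note rb = rho_bounds[OF B A', folded \<rho>_def]
  obtain a where a: "x' = hmap x A a" using obtain_coordinates[OF A] by metis
  obtain \<xi> where \<xi>: "A' p = A \<xi>" using normal_isometry_surj[OF A] by (metis surjD)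
  obtain \<pi> where \<pi>: "B p = A \<pi>" "fst \<pi> = fst p" "norm \<pi> = norm p"
    using change_of_isometry[OF A B] by metis
  obtain \<mu> where \<mu>: "inward_normal D x' = A \<mu>" using normal_isometry_surj[OF A] by (metis surjD)
  have na: "norm a = norm (x - x')"
    using norm_hmap_diff[OF A, of 0 a] a A by simp
  have n\<xi>: "norm \<xi> = norm p"
    using \<xi> normal_isometryD(2)[OF A] normal_isometryD(2)[OF A'] by metis
  have n\<mu>: "norm \<mu> = 1"
    using \<mu> normal_isometryD(2)[OF A, of \<mu>] normal_isometryD(2)[OF A', of e1] normal_isometryD(3)[OF A'] by (simp add: e1_def)
  have half: "norm w < \<epsilon> / 2" if "2 * norm w * (1 + 1 / \<eta>) < \<epsilon>" for w :: "'n espace"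
  proof -
    have "2 * norm w * 1 \<le> 2 * norm w * (1 + 1 / \<eta>)" using eta by (intro mult_left_mono) auto
    then show ?thesis using that by simp
  qed
  have n2: "norm p < \<epsilon> / 2" "norm a < \<epsilon> / 2" using half small na by auto
  have balls: "a \<in> ball 0 \<epsilon>" "\<pi> \<in> ball 0 \<epsilon>" using n2 \<pi>(3) norm_ge_zero[of p] by (auto simp del: norm_ge_zero)
  have fa: "fst a = \<psi> (snd a)" using mem_frontier_iff[OF balls(1)] a x' by simp
  have fp: "fst p = \<psi> (snd \<pi>)" using mem_frontier_iff[OF balls(2)] fr \<pi> by (simp add: hmap_def)
  have supp': "0 \<le> (u - a) \<bullet> \<mu>" if "hmap x A u \<in> closure D" for u
  proof -
    have "hmap x A u - x' = A (u - a)"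
      using a normal_isometryD(1)[OF A] by (simp add: hmap_def linear_diff)
    then show ?thesis using supp[OF that] \<mu> normal_isometry_inner[OF A] by simp
  qed
  note nm = normal_in_chart[OF balls(1) fa n\<mu> supp']
  have "\<mu> \<bullet> \<xi> = fst p"
    using normal_isometry_inner[OF A, of \<mu> \<xi>] \<mu> \<xi> inner_inward_normal[OF A', of p]
    by (simp add: inner_commute)
  then have "fst \<mu> * (fst \<xi> - \<psi>1 (snd a) (snd \<xi>)) = fst p"
    using nm(2)[of "snd \<xi>"] by (simp add: inner_prod_def algebra_simps)
  then have lin: "fst \<xi> - \<psi>1 (snd a) (snd \<xi>) = fst p / fst \<mu>"
    using nm(1) by (simp add: field_simps)
  note sn = norm_snd_le_norm
  have ns: "norm (snd a + snd \<xi>) \<le> norm a + norm p"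
    using norm_triangle_ineq[of "snd a" "snd \<xi>"] sn[of a] sn[of \<xi>] n\<xi> by simp
  then have "norm (snd a + snd \<xi>) * (1 + 1 / \<eta>) \<le> (norm a + norm p) * (1 + 1 / \<eta>)"
    using eta by (intro mult_right_mono) auto
  also have "\<dots> < \<epsilon>"
  proof -
    have "(u + v) * k < \<epsilon>" if "2 * u * k < \<epsilon>" "2 * v * k < \<epsilon>" for u v k :: real
      using that by (simp add: distrib_right)
    then show ?thesis using small na by simp
  qed
  finally have gsmall: "norm (snd (a + \<xi>)) * (1 + 1 / \<eta>) < \<epsilon>" by simp
  obtain b where b: "b \<in> frontier D"
    "norm (hmap x A (a + \<xi>) - b) \<le> \<bar>fst (a + \<xi>) - \<psi> (snd (a + \<xi>))\<bar>"
    using frontier_near_graph[OF gsmall] by metis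
  have eq: "hmap x A (a + \<xi>) = hmap x' A' p"
    using a \<xi> normal_isometryD(1)[OF A] by (simp add: hmap_def linear_add)
  have "norm (A \<xi> - A \<pi>) = norm (\<xi> - \<pi>)"
    using norm_hmap_diff[OF A, of \<xi> \<pi>] by (simp add: hmap_def)
  then have "norm (\<xi> - \<pi>) \<le> \<rho> * norm p"
    using rb(2)[of p] \<xi> \<pi> by (simp add: norm_minus_commute)
  then have n\<delta>: "norm (snd \<xi> - snd \<pi>) \<le> \<rho> * norm p" using sn[of "\<xi> - \<pi>"] by simp
  have T: "\<bar>(\<psi> (snd a + snd \<xi>) - \<psi> (snd a) - \<psi>1 (snd a) (snd \<xi>)) - \<psi> (snd \<pi>)\<bar>
      \<le> 2 * \<rho> * (norm p)\<^sup>2 / \<eta>"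
  proof (rule taylor_comparison)
    show "snd a + snd \<xi> \<in> ball 0 \<epsilon>" using ns n2 by simp
  qed (use n\<delta> sn[of a] sn[of \<xi>] sn[of \<pi>] na rb(1) n\<xi> \<pi>(3) n2 eps balls snd_in_ball in auto)
  have p1: "0 \<le> fst p" "fst p \<le> (norm p)\<^sup>2 / (2 * \<eta>)"
    using fst_le_of_frontier[OF B _ fr] n2(1) norm_ge_zero[of p] by (auto simp del: norm_ge_zero)
  have "norm (\<psi>1 (snd a)) \<le> norm a / \<eta>"
    using grad_bound[OF snd_in_ball[OF balls(1)]] sn[of a] eta
    by (meson divide_right_mono less_imp_le order_trans)
  then have "(norm (\<psi>1 (snd a)))\<^sup>2 \<le> (norm a / \<eta>)\<^sup>2" by (intro power_mono) auto
  also have "\<dots> = norm a * norm a / \<eta>\<^sup>2" by (simp add: power2_eq_square)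
  also have "\<dots> \<le> 1 * \<rho> / \<eta>\<^sup>2"
    using na rb n2 eps by (intro divide_right_mono mult_mono) auto
  finally have k: "1 / fst \<mu> - 1 \<le> \<rho> / \<eta>\<^sup>2" using nm(4) by simp
  have "fst p * (1 / fst \<mu> - 1) \<le> (norm p)\<^sup>2 / (2 * \<eta>) * (\<rho> / \<eta>\<^sup>2)"
    using p1 k nm(3) by (intro mult_mono) auto
  also have "\<dots> \<le> (norm p)\<^sup>2 / \<eta> * (\<rho> / \<eta>\<^sup>2)"
    using eta rb(3) by (intro mult_right_mono divide_left_mono) auto
  finally have "fst p * (1 / fst \<mu> - 1) \<le> \<rho> * (norm p)\<^sup>2 / \<eta> ^ 3"
    by (simp add: power3_eq_cube power2_eq_square mult.commute mult.left_commute)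
  moreover have "0 \<le> fst p * (1 / fst \<mu> - 1)" using p1 nm(3) by simp
  moreover have "fst (a + \<xi>) - \<psi> (snd (a + \<xi>)) = fst p * (1 / fst \<mu> - 1)
     - ((\<psi> (snd a + snd \<xi>) - \<psi> (snd a) - \<psi>1 (snd a) (snd \<xi>)) - \<psi> (snd \<pi>))"
    using lin fa fp by (simp add: algebra_simps)
  ultimately have "\<bar>fst (a + \<xi>) - \<psi> (snd (a + \<xi>))\<bar>
      \<le> \<rho> * (norm p)\<^sup>2 / \<eta> ^ 3 + 2 * \<rho> * (norm p)\<^sup>2 / \<eta>"
    using T by linarith
  also have "\<dots> = (1 / \<eta> ^ 3 + 2 / \<eta>) * \<rho> * (norm p)\<^sup>2" by (simp add: algebra_simps)
  finally show ?thesis using that b eq unfolding \<rho>_def by fastforce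
qed

end

section \<open>Global convexity\<close>

text \<open>
  A connected domain with uniform charts. The remaining geometric data used below, global
  convexity and its constants, are derived.
\<close>
locale strongly_convex_domain =
  fixes D :: "'n::finite espace set" and \<epsilon> \<eta> :: real
  assumes open_D: "open D" and bounded_D: "bounded D" and connected_D: "connected D"
    and eps: "0 < \<epsilon>" "\<epsilon> < 1" and eta: "0 < \<eta>"
    and chart: "\<And>x. x \<in> frontier D \<Longrightarrow> \<exists>A \<psi> \<psi>1 \<psi>2 \<psi>3. boundary_chart D \<epsilon> \<eta> x A \<psi> \<psi>1 \<psi>2 \<psi>3"
begin

lemma mem_frontier_D: "x \<in> frontier D \<longleftrightarrow> x \<in> closure D \<and> x \<notin> D"
  using open_D by (simp add: frontier_def interior_open)

lemma norm_inward_normal: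
  assumes "x \<in> frontier D"
  shows "norm (inward_normal D x) = 1"
proof -
  obtain A \<psi> \<psi>1 \<psi>2 \<psi>3 where "boundary_chart D \<epsilon> \<eta> x A \<psi> \<psi>1 \<psi>2 \<psi>3"
    using chart[OF assms] by blast
  then have A: "A \<in> normal_isometries D x" by (rule boundary_chart.A)
  show ?thesis using normal_isometryD(2)[OF A, of e1] normal_isometryD(3)[OF A] by (simp add: e1_def)
qed

text \<open>
  Near \<open>p\<close>, \<open>quadratic_support_local\<close> freed from the coordinates of the chart.
\<close>
lemma local_support:
  assumes p: "p \<in> frontier D" and X: "X \<in> closure D" "norm (X - p) < \<epsilon>"
  shows "\<eta> * (norm (X - p))\<^sup>2 \<le> (\<eta> + 2) * ((X - p) \<bullet> inward_normal D p)"
proof -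
  obtain A \<psi> \<psi>1 \<psi>2 \<psi>3 where "boundary_chart D \<epsilon> \<eta> p A \<psi> \<psi>1 \<psi>2 \<psi>3"
    using chart[OF p] by blast
  then interpret boundary_chart D \<epsilon> \<eta> p A \<psi> \<psi>1 \<psi>2 \<psi>3 .
  obtain u where u: "X = hmap p A u" using obtain_coordinates[OF A] by metis
  have Xp: "X - p = A u" using u by (simp add: hmap_def)
  then have nu: "norm (X - p) = norm u" using normal_isometryD(2)[OF A] by simp
  then have ub: "u \<in> ball 0 \<epsilon>" using X by simp
  have "\<psi> (snd u) \<le> fst u"
    using X(1) u mem_D_iff[OF ub] mem_frontier_iff[OF ub] mem_frontier_D by fastforce
  then show ?thesis
    using quadratic_support_local[OF ub] nu Xp inner_inward_normal[OF A, of u] by simp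
qed

text \<open>
  For \<open>y \<in> D\<close> the set \<open>S\<close> of the points of \<open>D\<close> that \<open>y\<close> sees along a segment inside \<open>D\<close> is open
  by compactness of segments. It is also closed in \<open>D\<close>: a limiting segment stays in the closure
  of \<open>D\<close>, and if it touched \<open>\<partial>D\<close>, then it would do so at an interior point \<open>p\<close> of the segment,
  where the strict local support at \<open>p\<close> forbids one of the two directions. As \<open>D\<close> is connected,
  \<open>S = D\<close>.
\<close>
lemma convex_D: "convex D"
proof -
  have "closed_segment y z \<subseteq> D" if y: "y \<in> D" and z: "z \<in> D" for y z
  proof -
    define S where "S = {z \<in> D. closed_segment y z \<subseteq> D}"
    have "openin (top_of_set D) S"
      unfolding openin_euclidean_subtopology_iff
    proof (intro conjI ballI)
      show "S \<subseteq> D" by (auto simp: S_def)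
      fix w assume w: "w \<in> S"
      obtain e where e: "e > 0" "(\<Union>v\<in>closed_segment y w. ball v e) \<subseteq> D"
        using w compact_subset_open_imp_ball_epsilon_subset[OF compact_segment open_D, of y w]
        by (auto simp: S_def)
      have "w' \<in> S" if w': "w' \<in> D" "dist w' w < e" for w'
        unfolding S_def
      proof (intro CollectI conjI subsetI)
        fix v assume "v \<in> closed_segment y w'"
        then obtain t where t: "0 \<le> t" "t \<le> 1" "v = (1 - t) *\<^sub>R y + t *\<^sub>R w'"
          by (auto simp: in_segment)
        let ?v = "(1 - t) *\<^sub>R y + t *\<^sub>R w"
        have "norm (t *\<^sub>R (w - w')) \<le> 1 * norm (w - w')"
          unfolding norm_scaleR using t by (intro mult_right_mono) auto
        then have "dist ?v v < e"
          using t(3) w'(2) by (simp add: dist_norm algebra_simps norm_minus_commute)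
        moreover have "?v \<in> closed_segment y w" using t by (auto simp: in_segment)
        ultimately show "v \<in> D" using e(2) mem_ball by blast
      qed (use w' in auto)
      then show "\<exists>e>0. \<forall>w'\<in>D. dist w' w < e \<longrightarrow> w' \<in> S" using e(1) by blast
    qed
    moreover have "closedin (top_of_set D) S"
    proof -
      have "w \<in> S" if w: "w \<in> D" "w \<in> closure S" for w
      proof -
        obtain W where W: "\<And>n. W n \<in> S" "W \<longlonglongrightarrow> w" using w(2) closure_sequential by blast
        have cl: "(1 - t) *\<^sub>R y + t *\<^sub>R w \<in> closure D" if t: "0 \<le> t" "t \<le> 1" for t
        proof -
          have "\<forall>n. (1 - t) *\<^sub>R y + t *\<^sub>R W n \<in> D"
          proof
            fix n
            have "(1 - t) *\<^sub>R y + t *\<^sub>R W n \<in> closed_segment y (W n)"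
              using t unfolding in_segment by blast
            then show "(1 - t) *\<^sub>R y + t *\<^sub>R W n \<in> D" using W(1)[of n] unfolding S_def by blast
          qed
          moreover have "(\<lambda>n. (1 - t) *\<^sub>R y + t *\<^sub>R W n) \<longlonglongrightarrow> (1 - t) *\<^sub>R y + t *\<^sub>R w"
            by (intro tendsto_intros W)
          ultimately show ?thesis unfolding closure_sequential by (intro exI conjI)
        qed
        have "p \<in> D" if p: "p \<in> closed_segment y w" for p
        proof (rule ccontr)
          assume "p \<notin> D"
          obtain t where t: "0 \<le> t" "t \<le> 1" "p = (1 - t) *\<^sub>R y + t *\<^sub>R w"
            using p by (auto simp: in_segment)
          have pf: "p \<in> frontier D" using \<open>p \<notin> D\<close> cl[OF t(1,2)] t(3) mem_frontier_D by simp
          have "t \<noteq> 0" "t \<noteq> 1" "y \<noteq> w" using \<open>p \<notin> D\<close> t w y by (auto simp: algebra_simps)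
          define \<tau> where "\<tau> = min (min t (1 - t)) (\<epsilon> / (2 * norm (w - y)))"
          have \<tau>: "0 < \<tau>" "\<tau> \<le> t" "\<tau> \<le> 1 - t" "\<tau> \<le> \<epsilon> / (2 * norm (w - y))"
            using t \<open>t \<noteq> 0\<close> \<open>t \<noteq> 1\<close> \<open>y \<noteq> w\<close> eps by (auto simp: \<tau>_def)
          have pos: "0 < \<sigma> * ((w - y) \<bullet> inward_normal D p)" if \<sigma>: "\<bar>\<sigma>\<bar> = \<tau>" for \<sigma>
          proof -
            have eq: "(1 - (t + \<sigma>)) *\<^sub>R y + (t + \<sigma>) *\<^sub>R w - p = \<sigma> *\<^sub>R (w - y)"
              using t by (simp add: algebra_simps)
            have n: "norm (\<sigma> *\<^sub>R (w - y)) = \<tau> * norm (w - y)" using \<sigma> by simp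
            have "\<tau> * norm (w - y) \<le> \<epsilon> / 2"
              using \<tau>(4) \<open>y \<noteq> w\<close> by (simp add: field_simps)
            then have "\<eta> * (\<tau> * norm (w - y))\<^sup>2 \<le> (\<eta> + 2) * (\<sigma> * ((w - y) \<bullet> inward_normal D p))"
              using local_support[OF pf cl, of "t + \<sigma>"] \<sigma> \<tau> eps t
              unfolding eq n by (auto simp: abs_if split: if_splits)
            moreover have "0 < \<eta> * (\<tau> * norm (w - y))\<^sup>2" using eta \<tau> \<open>y \<noteq> w\<close> by simp
            ultimately have "0 < (\<eta> + 2) * (\<sigma> * ((w - y) \<bullet> inward_normal D p))" by linarith
            then show ?thesis using eta by (simp add: zero_less_mult_iff)
          qed
          show False using pos[of \<tau>] pos[of "-\<tau>"] \<tau>(1) by simp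
        qed
        then show ?thesis using w(1) by (auto simp: S_def)
      qed
      then have "S = D \<inter> closure S" using closure_subset[of S] by (auto simp: S_def)
      then show ?thesis using closedin_closed_Int[OF closed_closure] by metis
    qed
    moreover have "S \<noteq> {}" using y by (auto simp: S_def)
    ultimately have "S = D" using connected_D connected_clopen by metis
    then show ?thesis using z by (auto simp: S_def)
  qed
  then show ?thesis by (simp add: convex_contains_segment)
qed

definition size_bound :: real where
  "size_bound = 1 + diameter (closure D)"

lemma size_bound: "1 \<le> size_bound" "X \<in> closure D \<Longrightarrow> Y \<in> closure D \<Longrightarrow> norm (X - Y) \<le> size_bound"
  using diameter_ge_0[of "closure D"] diameter_bounded_bound[of "closure D" X Y]
    bounded_closure[OF bounded_D]
  by (auto simp: size_bound_def dist_norm)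

definition convexity :: real where
  "convexity = \<eta> * (\<epsilon> / (2 * size_bound)) / (\<eta> + 2)"

lemma convexity_pos: "0 < convexity"
  using eta eps size_bound(1) by (simp add: convexity_def)

text \<open>
  By convexity \<open>X\<close> can be moved towards \<open>p\<close> until it lies in the chart at \<open>p\<close>. Contracting by
  the fixed factor \<open>\<tau>\<close> achieves this for all \<open>X\<close> at once, since \<open>D\<close> is bounded, and costs only a
  factor in the constant.
\<close>
lemma strong_support:
  assumes p: "p \<in> frontier D" and X: "X \<in> closure D"
  shows "convexity * (norm (X - p))\<^sup>2 \<le> (X - p) \<bullet> inward_normal D p"
proof -
  define \<tau> where "\<tau> = \<epsilon> / (2 * size_bound)"
  have \<tau>: "0 < \<tau>" "\<tau> \<le> 1" using eps size_bound(1) by (auto simp: \<tau>_def field_simps)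
  have pc: "p \<in> closure D" using p mem_frontier_D by blast
  define Y where "Y = (1 - \<tau>) *\<^sub>R p + \<tau> *\<^sub>R X"
  have Yc: "Y \<in> closure D"
    unfolding Y_def using convexD_alt[OF convex_closure[OF convex_D] pc X, of \<tau>] \<tau> by simp
  have Yp: "Y - p = \<tau> *\<^sub>R (X - p)" by (simp add: Y_def algebra_simps)
  have "norm (Y - p) = \<tau> * norm (X - p)" using Yp \<tau> by simp
  also have "\<dots> \<le> \<tau> * size_bound" using size_bound(2)[OF X pc] \<tau> by (intro mult_left_mono) auto
  also have "\<dots> < \<epsilon>" using eps size_bound(1) by (simp add: \<tau>_def)
  finally have "\<eta> * (norm (Y - p))\<^sup>2 \<le> (\<eta> + 2) * ((Y - p) \<bullet> inward_normal D p)"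
    by (rule local_support[OF p Yc])
  then have "\<tau> * (\<eta> * \<tau> * (norm (X - p))\<^sup>2) \<le> \<tau> * ((\<eta> + 2) * ((X - p) \<bullet> inward_normal D p))"
    unfolding Yp using \<tau> by (simp add: power_mult_distrib power2_eq_square mult.assoc mult.left_commute)
  then have "\<eta> * \<tau> * (norm (X - p))\<^sup>2 \<le> (\<eta> + 2) * ((X - p) \<bullet> inward_normal D p)"
    using \<tau>(1) by simp
  moreover have "convexity = \<eta> * \<tau> / (\<eta> + 2)" by (simp add: convexity_def \<tau>_def)
  ultimately show ?thesis using eta by (simp add: pos_divide_le_eq mult.commute)
qed

lemma half_space_support:
  assumes "p \<in> frontier D" "X \<in> closure D"
  shows "0 \<le> (X - p) \<bullet> inward_normal D p"
  using strong_support[OF assms] convexity_pos by (meson mult_nonneg_nonneg less_imp_le order_trans zero_le_power2)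

lemma bdist_nonneg: "0 \<le> bdist D X"
  by (simp add: bdist_def infdist_nonneg)

lemma bdist_le: "p \<in> frontier D \<Longrightarrow> bdist D X \<le> norm (X - p)"
  unfolding bdist_def dist_norm[symmetric] by (rule infdist_le)

lemma bdist_pos:
  assumes "X \<in> D" "frontier D \<noteq> {}"
  shows "0 < bdist D X"
proof -
  obtain b where "b \<in> frontier D" "bdist D X = dist X b"
    using infdist_attains_inf[OF frontier_closed assms(2)] unfolding bdist_def by metis
  then show ?thesis using assms(1) mem_frontier_D by auto
qed

text \<open>
  The ball around \<open>X\<close> with radius \<open>bdist D X\<close> lies in \<open>D\<close>, hence in the supporting half space at
  \<open>p\<close>; its point in direction \<open>- N\<close> gives the estimate.
\<close>
lemma bdist_le_support:
  assumes p: "p \<in> frontier D" and X: "X \<in> closure D"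
  shows "bdist D X \<le> (X - p) \<bullet> inward_normal D p"
proof (cases "X \<in> D")
  case False
  then have "bdist D X = 0" using X mem_frontier_D bdist_le[of X X] bdist_nonneg[of X] by simp
  then show ?thesis using half_space_support[OF p X] by simp
next
  case True
  let ?N = "inward_normal D p" and ?\<delta> = "bdist D X"
  have \<delta>: "0 < ?\<delta>" using bdist_pos[OF True] p by blast
  have "ball X ?\<delta> \<inter> frontier D = {}"
    using bdist_le[of _ X] by (force simp: dist_norm)
  moreover have "ball X ?\<delta> \<inter> D \<noteq> {}" using True \<delta> by force
  ultimately have "ball X ?\<delta> \<subseteq> D"
    using connected_Int_frontier[OF connected_ball, of X ?\<delta> D] by blast
  then have "cball X ?\<delta> \<subseteq> closure D"
    using closure_mono[of "ball X ?\<delta>" D] closure_ball[OF \<delta>, of X] by simp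
  moreover have "X - ?\<delta> *\<^sub>R ?N \<in> cball X ?\<delta>"
    using norm_inward_normal[OF p] \<delta> by (simp add: dist_norm)
  ultimately have "0 \<le> (X - ?\<delta> *\<^sub>R ?N - p) \<bullet> ?N"
    using half_space_support[OF p] by blast
  then show ?thesis
    using norm_inward_normal[OF p] by (simp add: inner_diff_left dot_square_norm)
qed

section \<open>Comparison of the boundary seen from two boundary points\<close>

text \<open>
  If \<open>p\<close> and \<open>x - x'\<close> are shorter than this, then all boundary points under comparison stay
  within the chart at \<open>x\<close>.
\<close>
definition small_radius :: real where
  "small_radius = \<epsilon> / (2 * (1 + 1 / \<eta>))"

text \<open>
  The summands are the constants of the three cases distinguished in \<open>frontier_near\<close>.
\<close>
definition proximity :: real where
  "proximity = 1 / \<eta> ^ 3 + 2 / \<eta> + 1 / (small_radius * \<eta>) + 1 / small_radius\<^sup>2 + 1 / small_radius"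

lemma small_radius_pos: "0 < small_radius"
  using eps eta by (simp add: small_radius_def add_pos_pos)

lemma less_small_radius: "r < small_radius \<longleftrightarrow> 2 * r * (1 + 1 / \<eta>) < \<epsilon>"
proof -
  have "0 < 1 + 1 / \<eta>" using eta by (simp add: add_pos_pos)
  then show ?thesis by (simp add: small_radius_def pos_less_divide_eq mult_ac)
qed

lemma proximity_ge:
  "1 / \<eta> ^ 3 + 2 / \<eta> \<le> proximity" "1 / (small_radius * \<eta>) \<le> proximity"
  "1 / small_radius\<^sup>2 + 1 / small_radius \<le> proximity" "0 \<le> proximity"
  using eta small_radius_pos by (auto simp: proximity_def)

text \<open>
  If \<open>p\<close> and \<open>x - x'\<close> are both small, this is \<open>frontier_near_local\<close>. If only \<open>p\<close> is small, then
  \<open>\<rho>\<close> is bounded below and the crude tangential estimates suffice. If \<open>p\<close> is not small, then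
  \<open>hmap x A p\<close> itself is a boundary point at distance at most \<open>\<rho> (1 + \<bar>p\<bar>)\<close>, which is
  \<open>O(\<rho> \<bar>p\<bar>\<^sup>2)\<close>.
\<close>
lemma frontier_near:
  assumes x: "x \<in> frontier D" and x': "x' \<in> frontier D"
    and A: "A \<in> normal_isometries D x" and A': "A' \<in> normal_isometries D x'"
    and fr: "hmap x A p \<in> frontier D"
  obtains b where "b \<in> frontier D"
    "norm (hmap x' A' p - b) \<le> proximity * rho x x' A A' * (norm p)\<^sup>2"
proof -
  define \<rho> where "\<rho> = rho x x' A A'"
  note rb = rho_bounds[OF A A', folded \<rho>_def]
  have mono: "k * \<rho> * (norm p)\<^sup>2 \<le> proximity * \<rho> * (norm p)\<^sup>2" if "k \<le> proximity" for k
    using that rb(3) by (intro mult_right_mono) auto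
  have "\<exists>b\<in>frontier D. norm (hmap x' A' p - b) \<le> proximity * \<rho> * (norm p)\<^sup>2"
  proof (cases "norm p < small_radius")
    case p: True
    obtain A0 \<psi> \<psi>1 \<psi>2 \<psi>3 where ch: "boundary_chart D \<epsilon> \<eta> x A0 \<psi> \<psi>1 \<psi>2 \<psi>3"
      using chart[OF x] by blast
    show ?thesis
    proof (cases "norm (x - x') < small_radius")
      case True
      obtain b where "b \<in> frontier D"
        "norm (hmap x' A' p - b) \<le> (1 / \<eta> ^ 3 + 2 / \<eta>) * \<rho> * (norm p)\<^sup>2"
        using boundary_chart.frontier_near_local[OF ch A A' x' half_space_support[OF x']
            p[unfolded less_small_radius] True[unfolded less_small_radius] fr]
        unfolding \<rho>_def by blast
      then show ?thesis using mono[OF proximity_ge(1)] by force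
    next
      case False
      have p\<epsilon>: "norm p * (1 + 1 / \<eta>) < \<epsilon>"
      proof -
        have "0 \<le> norm p * (1 + 1 / \<eta>)" using eta by simp
        then show ?thesis using p[unfolded less_small_radius] by (simp only: mult.assoc)
      qed
      have "norm p * 1 \<le> norm p * (1 + 1 / \<eta>)" using eta by (intro mult_left_mono) auto
      then have "norm p < \<epsilon>" using p\<epsilon> by linarith
      note f = boundary_chart.fst_le_of_frontier[OF ch A this fr]
      obtain A1 \<phi> \<phi>1 \<phi>2 \<phi>3 where ch': "boundary_chart D \<epsilon> \<eta> x' A1 \<phi> \<phi>1 \<phi>2 \<phi>3"
        using chart[OF x'] by blast
      obtain b where b: "b \<in> frontier D"
        "norm (hmap x' A' p - b) \<le> \<bar>fst p\<bar> + (norm p)\<^sup>2 / (2 * \<eta>)"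
        using boundary_chart.frontier_near_tangential[OF ch' A' p\<epsilon>] by blast
      note b(2)
      also have "\<bar>fst p\<bar> + (norm p)\<^sup>2 / (2 * \<eta>) \<le> 1 / \<eta> * 1 * (norm p)\<^sup>2"
        using f by (simp add: field_simps)
      also have "\<dots> \<le> 1 / \<eta> * (\<rho> / small_radius) * (norm p)\<^sup>2"
        using False rb(1) small_radius_pos eta by (intro mult_right_mono mult_left_mono) (auto simp: field_simps)
      also have "\<dots> = 1 / (small_radius * \<eta>) * \<rho> * (norm p)\<^sup>2" by simp
      also have "\<dots> \<le> proximity * \<rho> * (norm p)\<^sup>2" by (rule mono[OF proximity_ge(2)])
      finally show ?thesis using b(1) by blast
    qed
  next
    case False
    have "norm (hmap x' A' p - hmap x A p) \<le> norm (x - x') + norm (A p - A' p)"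
      using norm_triangle_ineq[of "x - x'" "A p - A' p"]
      by (simp add: hmap_def norm_minus_commute algebra_simps)
    also have "\<dots> \<le> \<rho> + \<rho> * norm p" using rb(1) rb(2)[of p] by linarith
    also have "\<dots> = (1 + norm p) * \<rho>" by (simp add: algebra_simps)
    also have "\<dots> \<le> ((1 / small_radius\<^sup>2 + 1 / small_radius) * (norm p)\<^sup>2) * \<rho>"
    proof (rule mult_right_mono[OF _ rb(3)])
      let ?t = "norm p / small_radius"
      have t: "1 \<le> ?t" using False small_radius_pos by simp
      have "1 \<le> ?t\<^sup>2" using t by (rule one_le_power)
      moreover have "norm p * 1 \<le> norm p * ?t" using t by (intro mult_left_mono) auto
      ultimately show "1 + norm p \<le> (1 / small_radius\<^sup>2 + 1 / small_radius) * (norm p)\<^sup>2"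
        by (simp add: power_divide algebra_simps power2_eq_square)
    qed
    also have "\<dots> = (1 / small_radius\<^sup>2 + 1 / small_radius) * \<rho> * (norm p)\<^sup>2" by simp
    also have "\<dots> \<le> proximity * \<rho> * (norm p)\<^sup>2" by (rule mono[OF proximity_ge(3)])
    finally show ?thesis using fr by blast
  qed
  then show ?thesis using that \<rho>_def by blast
qed

section \<open>Exit points\<close>

text \<open>
  The central estimate. Proximity provides \<open>b \<in> \<partial>D\<close> within \<open>K \<rho> \<bar>p\<bar>\<^sup>2\<close> of \<open>hmap x' A' p\<close>. The
  height over the supporting hyperplane at \<open>b\<close> is affine along the segment from \<open>hmap x' A' y\<close>
  to \<open>hmap x' A' q\<close>. At the two ends it is bounded below by \<open>strong_support\<close>, at \<open>y\<close> also by
  \<open>bdist_le_support\<close>, and averaging produces the term \<open>s (1 - s) L\<^sup>2\<close>. Heights are only compared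
  at points of the closure of \<open>D\<close>, which is why the support is taken in the copy of \<open>D\<close> that
  contains \<open>q\<close> and the depth of \<open>y\<close> has to be carried over from one copy to the other.
\<close>
lemma exit_gap:
  assumes x: "x \<in> frontier D" and x': "x' \<in> frontier D"
    and A: "A \<in> normal_isometries D x" and A': "A' \<in> normal_isometries D x'"
    and y: "hmap x' A' y \<in> closure D" and q: "hmap x' A' q \<in> closure D"
    and s: "0 \<le> s" "s \<le> 1" and p: "p = (1 - s) *\<^sub>R y + s *\<^sub>R q" "hmap x A p \<in> frontier D"
  shows "norm (p - q) * (bdist D (hmap x A y) + convexity * s * (norm (y - q))\<^sup>2)
    \<le> 8 * proximity * rho x x' A A' * norm (y - q) * ((norm y)\<^sup>2 + s * (norm (y - q))\<^sup>2)"
proof -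
  define \<kappa> where "\<kappa> = proximity * rho x x' A A'"
  define L where "L = norm (y - q)"
  define \<delta> where "\<delta> = bdist D (hmap x A y)"
  define \<delta>' where "\<delta>' = bdist D (hmap x' A' y)"
  have \<kappa>: "0 \<le> \<kappa>" using proximity_ge(4) rho_bounds(3)[OF A A'] by (simp add: \<kappa>_def)
  \<comment> \<open>The boundary point nearest to \<open>hmap x' A' y\<close> has coordinates \<open>w\<close> with \<open>\<bar>w\<bar> \<le> 2 \<bar>y\<bar>\<close>, and is
    near a boundary point of the other copy.\<close>
  have depth: "\<delta> \<le> \<delta>' + 4 * \<kappa> * (norm y)\<^sup>2"
  proof -
    obtain b where b: "b \<in> frontier D" "\<delta>' = dist (hmap x' A' y) b"
      using infdist_attains_inf[OF frontier_closed, of D "hmap x' A' y"] x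
      unfolding \<delta>'_def bdist_def by blast
    obtain w where w: "b = hmap x' A' w" using obtain_coordinates[OF A'] by metis
    obtain b' where b': "b' \<in> frontier D" "norm (hmap x A w - b') \<le> \<kappa> * (norm w)\<^sup>2"
      using frontier_near[OF x' x A' A, of w] b w rho_commute[of x' x A' A] \<kappa>_def by auto
    have yw: "norm (y - w) = \<delta>'"
      using b(2) w norm_hmap_diff[OF A', of y w] by (simp add: dist_norm)
    have "\<delta>' \<le> norm y"
      using bdist_le[OF x', of "hmap x' A' y"] norm_hmap_diff[OF A', of y 0] A'
      by (simp add: \<delta>'_def)
    then have "norm w \<le> 2 * norm y" using yw norm_triangle_sub[of w y] by (simp add: norm_minus_commute)
    then have "(norm w)\<^sup>2 \<le> (2 * norm y)\<^sup>2" by (intro power_mono) auto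
    then have "\<kappa> * (norm w)\<^sup>2 \<le> \<kappa> * (2 * norm y)\<^sup>2" using \<kappa> by (rule mult_left_mono)
    moreover have "\<delta> \<le> norm (hmap x A y - b')" unfolding \<delta>_def by (rule bdist_le[OF b'(1)])
    moreover have "norm (hmap x A y - b') \<le> norm (hmap x A y - hmap x A w) + norm (hmap x A w - b')"
      using norm_triangle_ineq[of "hmap x A y - hmap x A w" "hmap x A w - b'"] by simp
    ultimately show ?thesis
      using b'(2) yw norm_hmap_diff[OF A, of y w] by (simp add: power_mult_distrib)
  qed
  obtain b where b: "b \<in> frontier D" "norm (hmap x' A' p - b) \<le> \<kappa> * (norm p)\<^sup>2"
    using frontier_near[OF x x' A A' p(2)] \<kappa>_def by auto
  let ?N = "inward_normal D b" and ?Y = "hmap x' A' y" and ?Q = "hmap x' A' q"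
  have comb: "hmap x' A' p - b = (1 - s) *\<^sub>R (?Y - b) + s *\<^sub>R (?Q - b)"
    unfolding p(1) hmap_convex_comb[OF A'] by (simp add: algebra_simps)
  have "(1 - s) * ((?Y - b) \<bullet> ?N) + s * ((?Q - b) \<bullet> ?N) = (hmap x' A' p - b) \<bullet> ?N"
    unfolding comb by (simp add: inner_add_left)
  also have "\<dots> \<le> norm (hmap x' A' p - b)"
    using norm_cauchy_schwarz[of "hmap x' A' p - b" ?N] norm_inward_normal[OF b(1)] by simp
  also have "\<dots> \<le> \<kappa> * (norm p)\<^sup>2" by (rule b(2))
  finally have up: "(1 - s) * ((?Y - b) \<bullet> ?N) + s * ((?Q - b) \<bullet> ?N) \<le> \<kappa> * (norm p)\<^sup>2" .
  \<comment> \<open>Averaging the two lower bounds at \<open>y\<close> keeps both the depth and the quadratic term.\<close>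
  have "(\<delta>' + convexity * (norm (?Y - b))\<^sup>2) / 2 \<le> (?Y - b) \<bullet> ?N"
    using strong_support[OF b(1) y] bdist_le_support[OF b(1) y] by (simp add: \<delta>'_def)
  then have loY: "(1 - s) * ((\<delta>' + convexity * (norm (?Y - b))\<^sup>2) / 2) \<le> (1 - s) * ((?Y - b) \<bullet> ?N)"
    using s by (intro mult_left_mono) auto
  have "convexity * (norm (?Q - b))\<^sup>2 / 2 \<le> (?Q - b) \<bullet> ?N"
    using strong_support[OF b(1) q] half_space_support[OF b(1) q] by simp
  then have loQ: "s * (convexity * (norm (?Q - b))\<^sup>2 / 2) \<le> s * ((?Q - b) \<bullet> ?N)"
    using s by (intro mult_left_mono) auto
  \<comment> \<open>The variance of two points with weights \<open>1 - s\<close>, \<open>s\<close> is at most their second moment about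
    \<open>b\<close>.\<close>
  have "s * (1 - s) * L\<^sup>2 \<le> (1 - s) * (norm (?Y - b))\<^sup>2 + s * (norm (?Q - b))\<^sup>2"
  proof -
    have "(1 - s) * (norm (?Y - b))\<^sup>2 + s * (norm (?Q - b))\<^sup>2
        = s * (1 - s) * (norm (?Y - ?Q))\<^sup>2 + (norm ((1 - s) *\<^sub>R (?Y - b) + s *\<^sub>R (?Q - b)))\<^sup>2"
      unfolding power2_norm_eq_inner
      by (simp add: inner_commute inner_diff_left inner_diff_right inner_add_left inner_add_right algebra_simps)
    then show ?thesis using norm_hmap_diff[OF A', of y q] by (simp add: L_def)
  qed
  then have spread: "convexity * (s * (1 - s) * L\<^sup>2)
      \<le> convexity * ((1 - s) * (norm (?Y - b))\<^sup>2 + s * (norm (?Q - b))\<^sup>2)"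
    using convexity_pos by (intro mult_left_mono) auto
  have "(1 - s) * \<delta>' + convexity * (s * (1 - s) * L\<^sup>2) \<le> 2 * \<kappa> * (norm p)\<^sup>2"
  proof -
    have split: "(1 - s) * ((\<delta>' + convexity * a) / 2) = ((1 - s) * \<delta>' + convexity * ((1 - s) * a)) / 2"
      "s * (convexity * a / 2) = convexity * (s * a) / 2" for a
      by (simp_all add: algebra_simps)
    have "e + d \<le> 2 * h" if "(e + a) / 2 \<le> f" "b / 2 \<le> g" "f + g \<le> h" "d \<le> a + b"
      for a b d e f g h :: real
    proof -
      have "(e + a) / 2 + b / 2 \<le> h" using add_mono[OF that(1,2)] that(3) by (rule order_trans)
      then have "e + (a + b) \<le> 2 * h" by (simp add: field_simps)
      then show ?thesis using that(4) by simp
    qed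
    from this[OF loY[unfolded split] loQ[unfolded split] up spread[unfolded distrib_left[of convexity]]]
    show ?thesis by (simp only: mult.assoc)
  qed
  moreover have "(1 - s) * \<delta> \<le> (1 - s) * \<delta>' + 4 * \<kappa> * (norm y)\<^sup>2"
  proof -
    have "(1 - s) * \<delta> \<le> (1 - s) * (\<delta>' + 4 * \<kappa> * (norm y)\<^sup>2)"
      using depth s by (intro mult_left_mono) auto
    also have "\<dots> \<le> (1 - s) * \<delta>' + 4 * \<kappa> * (norm y)\<^sup>2"
      using s \<kappa> mult_left_le_one_le[of "4 * \<kappa> * (norm y)\<^sup>2" "1 - s"] by (simp add: distrib_left)
    finally show ?thesis .
  qed
  ultimately have up': "(1 - s) * (\<delta> + convexity * s * L\<^sup>2) \<le> 2 * \<kappa> * (norm p)\<^sup>2 + 4 * \<kappa> * (norm y)\<^sup>2"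
    by (simp add: algebra_simps)
  have "(norm p)\<^sup>2 \<le> 2 * (norm y)\<^sup>2 + 2 * (s * L\<^sup>2)"
  proof -
    have "p = y - s *\<^sub>R (y - q)" by (simp add: p(1) algebra_simps)
    then have "norm p \<le> norm y + s * L"
      using norm_triangle_ineq4[of y "s *\<^sub>R (y - q)"] s by (simp add: L_def)
    then have "(norm p)\<^sup>2 \<le> (norm y + s * L)\<^sup>2" by (intro power_mono) auto
    also have "\<dots> \<le> 2 * (norm y)\<^sup>2 + 2 * (s * L)\<^sup>2"
      using sum_squares_bound[of "norm y" "s * L"] by (simp add: power2_sum)
    also have "(s * L)\<^sup>2 \<le> s * L\<^sup>2"
    proof -
      have "s * s \<le> s" using s by (simp add: mult_left_le)
      then have "s * s * L\<^sup>2 \<le> s * L\<^sup>2" by (intro mult_right_mono) auto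
      then show ?thesis by (simp only: power_mult_distrib power2_eq_square[of s])
    qed
    finally show ?thesis by simp
  qed
  then have "2 * \<kappa> * (norm p)\<^sup>2 \<le> 2 * \<kappa> * (2 * (norm y)\<^sup>2 + 2 * (s * L\<^sup>2))"
    using \<kappa> by (intro mult_left_mono) auto
  moreover have "2 * \<kappa> * (2 * (norm y)\<^sup>2 + 2 * (s * L\<^sup>2)) + 4 * \<kappa> * (norm y)\<^sup>2 + 4 * (\<kappa> * (s * L\<^sup>2))
      = 8 * \<kappa> * ((norm y)\<^sup>2 + s * L\<^sup>2)"
    by (simp add: algebra_simps)
  moreover have "0 \<le> \<kappa> * (s * L\<^sup>2)" using \<kappa> s by simp
  ultimately have "(1 - s) * (\<delta> + convexity * s * L\<^sup>2) \<le> 8 * \<kappa> * ((norm y)\<^sup>2 + s * L\<^sup>2)"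
    using up' by linarith
  then have "L * ((1 - s) * (\<delta> + convexity * s * L\<^sup>2)) \<le> L * (8 * \<kappa> * ((norm y)\<^sup>2 + s * L\<^sup>2))"
    by (rule mult_left_mono) (simp add: L_def)
  moreover have "norm (p - q) = (1 - s) * L"
  proof -
    have "p - q = (1 - s) *\<^sub>R (y - q)" by (simp add: p(1) algebra_simps)
    then show ?thesis using s by (simp add: L_def)
  qed
  ultimately show ?thesis
    by (simp add: \<kappa>_def L_def[symmetric] \<delta>_def[symmetric] mult_ac)
qed

lemma norm_coordinates_le:
  assumes "x \<in> frontier D" "A \<in> normal_isometries D x" "hmap x A u \<in> closure D"
  shows "norm u \<le> size_bound"
  using size_bound(2)[of "hmap x A u" x] norm_hmap_diff[OF assms(2), of u 0] assms mem_frontier_D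
  by simp

lemma coordinates_dist_le:
  assumes "A \<in> normal_isometries D x" "hmap x A u \<in> closure D" "hmap x A v \<in> closure D"
  shows "norm (u - v) \<le> size_bound"
  using size_bound(2)[OF assms(2,3)] norm_hmap_diff[OF assms(1), of u v] by simp

text \<open>
  The two isometries map \<open>p\<close> to points within \<open>\<rho> \<bar>p\<bar>\<close> of each other, so up to this error the two
  images differ by the translation \<open>x - x'\<close> and by \<open>A' (p - q)\<close>.
\<close>
lemma displacement_comparison:
  assumes A: "A \<in> normal_isometries D x" and A': "A' \<in> normal_isometries D x'"
  shows "\<bar>norm (hmap x A p - hmap x' A' q) - norm (x - x')\<bar> \<le> rho x x' A A' * norm p + norm (p - q)"
proof -
  have "hmap x A p - hmap x' A' q - (x - x') = (A p - A' p) + (hmap x' A' p - hmap x' A' q)"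
    by (simp add: hmap_def)
  then have "norm (hmap x A p - hmap x' A' q - (x - x')) \<le> norm (A p - A' p) + norm (p - q)"
    using norm_triangle_ineq norm_hmap_diff[OF A'] by metis
  then show ?thesis
    using norm_triangle_ineq3[of "hmap x A p - hmap x' A' q" "x - x'"] rho_bounds(2)[OF A A', of p]
    by linarith
qed

definition lipschitz_const :: real where
  "lipschitz_const = 8 * proximity * size_bound * (size_bound + 1 / convexity) + 2 * size_bound"

lemma lipschitz_const_ge:
  "8 * proximity * size_bound / convexity + size_bound \<le> lipschitz_const"
  "2 * size_bound \<le> lipschitz_const" "0 < lipschitz_const"
proof -
  have "8 * proximity * size_bound * (1 / convexity)
      \<le> 8 * proximity * size_bound * (size_bound + 1 / convexity)"
    using size_bound(1) proximity_ge(4) by (intro mult_left_mono) auto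
  then show "8 * proximity * size_bound / convexity + size_bound \<le> lipschitz_const"
    using size_bound(1) by (simp add: lipschitz_const_def)
  have "0 \<le> 8 * proximity * size_bound * (size_bound + 1 / convexity)"
    using size_bound(1) proximity_ge(4) convexity_pos by simp
  then show "2 * size_bound \<le> lipschitz_const" by (simp add: lipschitz_const_def)
  then show "0 < lipschitz_const" using size_bound(1) by linarith
qed

text \<open>
  The segment leaves the first copy of \<open>D\<close> at parameter \<open>\<theta>\<close>, and \<open>\<theta>'\<close> is a later parameter at
  which it is still in the closure of the second copy. This covers a later exit point as well as
  an end point that does not leave \<open>D\<close>. The gap \<open>\<bar>p - q\<bar>\<close> is bounded by \<open>exit_gap\<close>. The
  remaining term \<open>\<rho> \<bar>p\<bar>\<close> is controlled through \<open>\<bar>p\<bar> \<le> \<bar>z\<bar> + \<bar>y - z\<bar>\<close> and \<open>\<delta> \<le> \<bar>y\<bar>\<close>, the latter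
  because \<open>x\<close> is a boundary point.
\<close>
lemma exit_comparison_from_inside:
  assumes x: "x \<in> frontier D" and x': "x' \<in> frontier D"
    and A: "A \<in> normal_isometries D x" and A': "A' \<in> normal_isometries D x'"
    and y: "hmap x A y \<in> D" "hmap x' A' y \<in> closure D"
    and \<theta>: "0 < \<theta>" "\<theta> \<le> \<theta>'" "\<theta>' \<le> 1"
    and p: "hmap x A (y + \<theta> *\<^sub>R (z - y)) \<in> frontier D"
    and q: "hmap x' A' (y + \<theta>' *\<^sub>R (z - y)) \<in> closure D"
    and \<delta>: "0 < \<delta>" "\<delta> \<le> bdist D (hmap x A y)"
  shows "\<bar>norm (hmap x A (y + \<theta> *\<^sub>R (z - y)) - hmap x' A' (y + \<theta>' *\<^sub>R (z - y))) - norm (x - x')\<bar>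
    \<le> lipschitz_const * rho x x' A A' * (min (norm z) 1 + norm y * min (norm (y - z)) 1 / \<delta>)"
proof -
  define \<rho> where "\<rho> = rho x x' A A'"
  define P where "P = y + \<theta> *\<^sub>R (z - y)"
  define Q where "Q = y + \<theta>' *\<^sub>R (z - y)"
  define m where "m = min (norm (y - z)) 1"
  define M where "M = size_bound"
  define c where "c = convexity"
  define K where "K = proximity"
  have \<rho>0: "0 \<le> \<rho>" using rho_bounds(3)[OF A A'] by (simp add: \<rho>_def)
  have M: "1 \<le> M" using size_bound(1) by (simp add: M_def)
  have c: "0 < c" using convexity_pos by (simp add: c_def)
  have K: "0 \<le> K" using proximity_ge(4) by (simp add: K_def)
  have m: "0 \<le> m" by (simp add: m_def)
  let ?\<beta> = "bdist D (hmap x A y)"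
  have "?\<beta> \<le> norm y"
    using bdist_le[OF x, of "hmap x A y"] norm_hmap_diff[OF A, of y 0] A by simp
  then have yd: "1 \<le> norm y / \<delta>" using \<delta> by simp
  have ym: "m \<le> norm y * m / \<delta>"
    using mult_right_mono[OF yd m] by simp
  have yM: "norm y \<le> M"
    using norm_coordinates_le[OF x A, of y] y(1) closure_subset[of D] unfolding M_def by blast
  have L: "norm (y - Q) \<le> M * m"
  proof (cases "norm (y - z) \<le> 1")
    case True
    have "norm (y - Q) = \<theta>' * norm (y - z)" using \<theta> by (simp add: Q_def norm_minus_commute)
    also have "\<dots> \<le> M * norm (y - z)" using \<theta> M by (intro mult_right_mono) auto
    finally show ?thesis using True by (simp add: m_def)
  next
    case False
    then show ?thesis using coordinates_dist_le[OF A' y(2) q] by (simp add: m_def M_def Q_def)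
  qed
  have gap: "norm (P - Q) \<le> (8 * K * M * (M + 1 / c)) * \<rho> * (norm y * m / \<delta>)"
  proof -
    define s where "s = \<theta> / \<theta>'"
    have s: "0 \<le> s" "s \<le> 1" using \<theta> by (auto simp: s_def)
    have "s * \<theta>' = \<theta>" using \<theta> by (simp add: s_def)
    then have Ps: "P = (1 - s) *\<^sub>R y + s *\<^sub>R Q" by (simp add: P_def Q_def algebra_simps)
    let ?L = "norm (y - Q)"
    have "norm (P - Q) * (?\<beta> + c * s * ?L\<^sup>2) \<le> 8 * K * \<rho> * ?L * ((norm y)\<^sup>2 + s * ?L\<^sup>2)"
      using exit_gap[OF x x' A A' y(2) q[folded Q_def] s Ps p[folded P_def]]
      by (simp add: \<rho>_def c_def K_def)
    also have "(norm y)\<^sup>2 + s * ?L\<^sup>2 \<le> ((norm y)\<^sup>2 / \<delta> + 1 / c) * (?\<beta> + c * s * ?L\<^sup>2)"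
    proof -
      have "(norm y)\<^sup>2 = (norm y)\<^sup>2 / \<delta> * \<delta>" using \<delta> by simp
      also have "\<dots> \<le> (norm y)\<^sup>2 / \<delta> * ?\<beta>" using \<delta> by (intro mult_left_mono) auto
      finally have "(norm y)\<^sup>2 \<le> (norm y)\<^sup>2 / \<delta> * ?\<beta>" .
      moreover have "s * ?L\<^sup>2 = 1 / c * (c * s * ?L\<^sup>2)" using c by simp
      moreover have "0 \<le> (norm y)\<^sup>2 / \<delta> * (c * s * ?L\<^sup>2)" "0 \<le> 1 / c * ?\<beta>"
        using \<delta> c s by auto
      ultimately show ?thesis by (simp only: distrib_left distrib_right)
    qed
    finally have "norm (P - Q) * (?\<beta> + c * s * ?L\<^sup>2)
        \<le> (8 * K * \<rho> * ?L * ((norm y)\<^sup>2 / \<delta> + 1 / c)) * (?\<beta> + c * s * ?L\<^sup>2)"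
      using K \<rho>0 by (simp add: mult_left_mono mult.assoc)
    moreover have "0 < ?\<beta> + c * s * ?L\<^sup>2" using \<delta> c s by (simp add: add_pos_nonneg)
    ultimately have "norm (P - Q) \<le> 8 * K * \<rho> * ?L * ((norm y)\<^sup>2 / \<delta> + 1 / c)"
      by (rule mult_right_le_imp_le)
    also have "\<dots> \<le> 8 * K * \<rho> * (M * m) * ((M + 1 / c) * (norm y / \<delta>))"
    proof (intro mult_mono mult_left_mono L)
      have "1 / c \<le> 1 / c * (norm y / \<delta>)" using mult_left_mono[OF yd, of "1 / c"] c by simp
      moreover have "(norm y)\<^sup>2 / \<delta> \<le> M * (norm y / \<delta>)"
        using mult_right_mono[OF yM, of "norm y / \<delta>"] \<delta> by (simp add: power2_eq_square)
      ultimately show "(norm y)\<^sup>2 / \<delta> + 1 / c \<le> (M + 1 / c) * (norm y / \<delta>)"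
        by (simp only: distrib_right)
    qed (use K \<rho>0 M m c \<delta> in auto)
    finally show ?thesis by (simp add: mult_ac)
  qed
  have PM: "norm P \<le> M"
    using norm_coordinates_le[OF x A, of P] p mem_frontier_D unfolding M_def P_def by blast
  have P: "norm P \<le> M * (min (norm z) 1 + m)"
  proof (cases "norm z \<le> 1 \<and> norm (y - z) \<le> 1")
    case True
    have "P = z + (1 - \<theta>) *\<^sub>R (y - z)" by (simp add: P_def algebra_simps)
    then have "norm P \<le> norm z + (1 - \<theta>) * norm (y - z)"
      using norm_triangle_ineq[of z "(1 - \<theta>) *\<^sub>R (y - z)"] \<theta> by simp
    also have "\<dots> \<le> 1 * (norm z + norm (y - z))"
      using \<theta> mult_right_mono[of "1 - \<theta>" 1 "norm (y - z)"] by simp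
    also have "\<dots> \<le> M * (norm z + norm (y - z))" using M by (intro mult_right_mono) auto
    finally show ?thesis using True by (simp add: m_def)
  next
    case False
    then have "1 \<le> min (norm z) 1 + m" by (auto simp: m_def min_def)
    then have "M * 1 \<le> M * (min (norm z) 1 + m)" using M by (intro mult_left_mono) auto
    then show ?thesis using PM by simp
  qed
  let ?R = "norm y * m / \<delta>"
  have "\<bar>norm (hmap x A P - hmap x' A' Q) - norm (x - x')\<bar> \<le> \<rho> * norm P + norm (P - Q)"
    unfolding \<rho>_def by (rule displacement_comparison[OF A A'])
  also have "\<rho> * norm P \<le> \<rho> * (M * (min (norm z) 1 + ?R))"
    using P ym M \<rho>0 by (intro mult_left_mono order_trans[OF P]) auto
  also have "\<rho> * (M * (min (norm z) 1 + ?R)) + norm (P - Q)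
      \<le> \<rho> * (M * (min (norm z) 1 + ?R)) + (8 * K * M * (M + 1 / c)) * \<rho> * (min (norm z) 1 + ?R)"
  proof -
    have "(8 * K * M * (M + 1 / c)) * \<rho> * ?R \<le> (8 * K * M * (M + 1 / c)) * \<rho> * (min (norm z) 1 + ?R)"
      using K M c \<rho>0 by (intro mult_left_mono) auto
    then show ?thesis using gap by linarith
  qed
  also have "\<dots> = (8 * K * M * (M + 1 / c) + M) * \<rho> * (min (norm z) 1 + ?R)"
  proof -
    have "\<rho> * (M * u) + k * \<rho> * u = (k + M) * \<rho> * u" for k u
      by (simp add: algebra_simps)
    then show ?thesis .
  qed
  also have "\<dots> \<le> lipschitz_const * \<rho> * (min (norm z) 1 + ?R)"
    using \<rho>0 m \<delta> M
    by (intro mult_right_mono) (auto simp: lipschitz_const_def K_def M_def c_def)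
  finally show ?thesis by (simp add: P_def Q_def m_def \<rho>_def)
qed

text \<open>
  With \<open>y = 0\<close> the depth vanishes and \<open>exit_gap\<close> has the factor \<open>s L\<^sup>2\<close> on both sides. It can be
  cancelled because \<open>s > 0\<close>: the exit point is not the origin itself.
\<close>
lemma exit_comparison_from_origin:
  assumes x: "x \<in> frontier D" and x': "x' \<in> frontier D"
    and A: "A \<in> normal_isometries D x" and A': "A' \<in> normal_isometries D x'"
    and \<theta>: "0 < \<theta>" "\<theta> \<le> \<theta>'"
    and p: "hmap x A (\<theta> *\<^sub>R z) \<in> frontier D" and q: "hmap x' A' (\<theta>' *\<^sub>R z) \<in> closure D"
  shows "\<bar>norm (hmap x A (\<theta> *\<^sub>R z) - hmap x' A' (\<theta>' *\<^sub>R z)) - norm (x - x')\<bar>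
    \<le> lipschitz_const * rho x x' A A'"
proof -
  define s where "s = \<theta> / \<theta>'"
  have s: "0 < s" "s \<le> 1" "s * \<theta>' = \<theta>" using \<theta> by (auto simp: s_def)
  let ?P = "\<theta> *\<^sub>R z" and ?Q = "\<theta>' *\<^sub>R z" and ?\<rho> = "rho x x' A A'"
  have \<rho>0: "0 \<le> ?\<rho>" by (rule rho_bounds(3)[OF A A'])
  have cl: "hmap x' A' 0 \<in> closure D" using A' x' mem_frontier_D by simp
  have "bdist D (hmap x A 0) = 0" using A bdist_le[OF x, of x] bdist_nonneg[of x] by simp
  then have "norm (?P - ?Q) * (convexity * s * (norm ?Q)\<^sup>2)
      \<le> 8 * proximity * ?\<rho> * norm ?Q * (s * (norm ?Q)\<^sup>2)"
    using exit_gap[OF x x' A A' cl q less_imp_le[OF s(1)] s(2) _ p] s by simp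
  then have "(norm (?P - ?Q) * convexity) * (s * (norm ?Q)\<^sup>2)
      \<le> (8 * proximity * ?\<rho> * norm ?Q) * (s * (norm ?Q)\<^sup>2)" by (simp only: mult_ac)
  then have "norm (?P - ?Q) * convexity \<le> 8 * proximity * ?\<rho> * norm ?Q"
  proof (cases "?Q = 0")
    case False
    then have "0 < s * (norm ?Q)\<^sup>2" using s by simp
    then show "(norm (?P - ?Q) * convexity) * (s * (norm ?Q)\<^sup>2)
      \<le> (8 * proximity * ?\<rho> * norm ?Q) * (s * (norm ?Q)\<^sup>2) \<Longrightarrow> ?thesis"
      by (metis mult_le_cancel_right_pos)
  qed (use \<theta> in auto)
  also have "\<dots> \<le> 8 * proximity * ?\<rho> * size_bound"
    using norm_coordinates_le[OF x' A' q] proximity_ge(4) \<rho>0 by (intro mult_left_mono) auto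
  finally have "norm (?P - ?Q) \<le> 8 * proximity * ?\<rho> * size_bound / convexity"
    by (simp only: pos_le_divide_eq[OF convexity_pos])
  then have "norm (?P - ?Q) \<le> 8 * proximity * size_bound / convexity * ?\<rho>"
    by (simp add: mult_ac)
  moreover have "norm ?P \<le> size_bound"
    using norm_coordinates_le[OF x A] p mem_frontier_D by blast
  then have "?\<rho> * norm ?P \<le> ?\<rho> * size_bound" using \<rho>0 by (rule mult_left_mono)
  moreover have "(8 * proximity * size_bound / convexity + size_bound) * ?\<rho> \<le> lipschitz_const * ?\<rho>"
    using lipschitz_const_ge(1) \<rho>0 by (rule mult_right_mono)
  ultimately show ?thesis
    using displacement_comparison[OF A A', of ?P ?Q]
    unfolding distrib_right mult.commute[of ?\<rho> size_bound] by linarith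
qed

section \<open>The stopped map\<close>

text \<open>
  At the first of two exit points, strict support on the side of \<open>y\<close> means that the segment
  points strictly out of the supporting half space there, so no later point of it lies in the
  closure of \<open>D\<close>.
\<close>
lemma exit_point_unique:
  assumes y: "y \<in> closure D" and p: "p \<in> ocsegment y z \<inter> frontier D" and q: "q \<in> ocsegment y z \<inter> frontier D"
  shows "p = q"
proof -
  have False if y: "y \<in> closure D" and fr: "y + s *\<^sub>R v \<in> frontier D" "y + t *\<^sub>R v \<in> frontier D"
    and st: "0 < s" "s < t" and v: "v \<noteq> 0" for s t :: real and v
  proof -
    let ?p = "y + s *\<^sub>R v"
    let ?N = "inward_normal D ?p"
    have "convexity * (norm (y - ?p))\<^sup>2 \<le> (y - ?p) \<bullet> ?N" by (rule strong_support[OF fr(1) y])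
    moreover have "0 < convexity * (norm (y - ?p))\<^sup>2" using convexity_pos st v by simp
    ultimately have "0 < - s * (v \<bullet> ?N)" by simp
    moreover have "0 \<le> ((y + t *\<^sub>R v) - ?p) \<bullet> ?N"
      using half_space_support[OF fr(1)] fr(2) mem_frontier_D by blast
    then have "0 \<le> (t - s) * (v \<bullet> ?N)" by (simp add: algebra_simps)
    ultimately show False using st by (simp add: zero_le_mult_iff mult_less_0_iff)
  qed
  moreover obtain s t where st: "0 < s" "p = y + s *\<^sub>R (z - y)" "0 < t" "q = y + t *\<^sub>R (z - y)"
    using p q by (auto simp: ocsegment_def)
  ultimately have "z - y = 0 \<or> s = t"
    using y p q by (metis IntD2 linorder_neqE_linordered_idom)
  then show ?thesis using st by fastforce
qed

lemma Lam_eq_exit_point: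
  assumes y: "y \<in> closure D" and z: "z \<notin> D" and p: "p \<in> ocsegment y z" "p \<in> frontier D"
  shows "Lam D y z = p"
proof (cases "z \<in> closure D")
  case True
  have "z \<in> ocsegment y z" unfolding ocsegment_def by (auto intro!: exI[of _ 1])
  then show ?thesis
    using exit_point_unique[OF y, of z z p] p z True mem_frontier_D by (simp add: Lam_def)
next
  case False
  have "(THE p. p \<in> ocsegment y z \<inter> frontier D) = p"
    using p by (intro the_equality) (auto intro: exit_point_unique[OF y])
  then show ?thesis using False p by (auto simp: Lam_def)
qed

lemma Lam_in_closure:
  assumes y: "y \<in> closure D"
  shows "Lam D y z \<in> closure D"
proof -
  consider "z \<in> closure D" | "z \<notin> closure D" "ocsegment y z \<inter> frontier D = {}"
    | p where "z \<notin> closure D" "p \<in> ocsegment y z" "p \<in> frontier D" by blast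
  then show ?thesis
  proof cases
    case (3 p)
    have "z \<notin> D" using 3(1) closure_subset[of D] by blast
    then show ?thesis using Lam_eq_exit_point[OF y _ 3(2,3)] 3(3) mem_frontier_D by simp
  qed (use y in \<open>simp_all add: Lam_def\<close>)
qed

lemma hmap_along_segment:
  assumes "A \<in> normal_isometries D x"
  shows "hmap x A (y + \<theta> *\<^sub>R (z - y)) = hmap x A y + \<theta> *\<^sub>R (hmap x A z - hmap x A y)"
  using normal_isometryD(1)[OF assms] by (simp add: hmap_def linear_add linear_diff linear_scale)

lemma mem_ocsegment_hmap:
  assumes "A \<in> normal_isometries D x"
  shows "p \<in> ocsegment (hmap x A y) (hmap x A z)
    \<longleftrightarrow> (\<exists>\<theta>. 0 < \<theta> \<and> \<theta> \<le> 1 \<and> p = hmap x A (y + \<theta> *\<^sub>R (z - y)))"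
  unfolding ocsegment_def hmap_along_segment[OF assms] by blast

lemma gbar_eq_exit_point:
  assumes "A \<in> normal_isometries D x" "hmap x A y \<in> closure D" "hmap x A z \<notin> D" "0 < \<theta>" "\<theta> \<le> 1"
    and "hmap x A (y + \<theta> *\<^sub>R (z - y)) \<in> frontier D"
  shows "gbar D x A y z = hmap x A (y + \<theta> *\<^sub>R (z - y))"
  unfolding gbar_def
  using assms(4-6) mem_ocsegment_hmap[OF assms(1)] by (intro Lam_eq_exit_point assms(2,3)) blast+

lemma gbar_exit_from_inside:
  assumes A: "A \<in> normal_isometries D x" and y: "hmap x A y \<in> D" and z: "hmap x A z \<notin> D"
  obtains \<theta> where "0 < \<theta>" "\<theta> \<le> 1" "hmap x A (y + \<theta> *\<^sub>R (z - y)) \<in> frontier D"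
    "gbar D x A y z = hmap x A (y + \<theta> *\<^sub>R (z - y))"
proof -
  have "closed_segment (hmap x A y) (hmap x A z) \<inter> frontier D \<noteq> {}"
    using y z by (intro connected_Int_frontier) auto
  then obtain \<theta> where t: "0 \<le> \<theta>" "\<theta> \<le> 1" "(1 - \<theta>) *\<^sub>R hmap x A y + \<theta> *\<^sub>R hmap x A z \<in> frontier D"
    by (auto simp: in_segment)
  have "(1 - \<theta>) *\<^sub>R hmap x A y + \<theta> *\<^sub>R hmap x A z = hmap x A (y + \<theta> *\<^sub>R (z - y))"
    unfolding hmap_convex_comb[OF A, symmetric] by (simp add: algebra_simps)
  then have fr: "hmap x A (y + \<theta> *\<^sub>R (z - y)) \<in> frontier D" using t by simp
  have "\<theta> \<noteq> 0"
  proof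
    assume "\<theta> = 0"
    then show False using fr y mem_frontier_D by simp
  qed
  then have "0 < \<theta>" using t(1) by simp
  moreover have "hmap x A y \<in> closure D" using y closure_subset[of D] by blast
  ultimately show ?thesis using that t(2) fr gbar_eq_exit_point[OF A _ z] by blast
qed

text \<open>
  Along the ray through \<open>z\<close> the height grows linearly in \<open>t\<close> and \<open>\<psi>\<close> only quadratically.
\<close>
lemma enters_domain:
  assumes x: "x \<in> frontier D" and isoA: "A \<in> normal_isometries D x" and z: "0 < fst z"
  obtains t where "0 < t" "t < 1" "hmap x A (t *\<^sub>R z) \<in> D"
proof -
  obtain B \<psi> \<psi>1 \<psi>2 \<psi>3 where "boundary_chart D \<epsilon> \<eta> x B \<psi> \<psi>1 \<psi>2 \<psi>3"
    using chart[OF x] by blast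
  then interpret boundary_chart D \<epsilon> \<eta> x B \<psi> \<psi>1 \<psi>2 \<psi>3 .
  obtain u where u: "A z = B u" "fst u = fst z"
    using change_of_isometry[OF A isoA] by metis
  have AB: "hmap x A (t *\<^sub>R z) = hmap x B (t *\<^sub>R u)" for t
    using u normal_isometryD(1)[OF A] normal_isometryD(1)[OF isoA]
    by (simp add: hmap_def linear_scale)
  define t where "t = min (1 / 2) (min (\<epsilon> / (2 * (norm u + 1))) (\<eta> * fst u / ((norm (snd u))\<^sup>2 + 1)))"
  have pos: "0 < norm u + 1" "0 < (norm (snd u))\<^sup>2 + 1"
    by (auto intro: add_nonneg_pos)
  have t: "0 < t" "t \<le> 1 / 2" "t \<le> \<epsilon> / (2 * (norm u + 1))" "t \<le> \<eta> * fst u / ((norm (snd u))\<^sup>2 + 1)"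
    unfolding t_def using eps eta u(2) z pos
    by (simp_all only: min_less_iff_conj min.cobounded1 min.coboundedI1 min.coboundedI2) auto
  have "t * (norm u + 1) \<le> \<epsilon> / 2" using t(3) pos by (simp add: field_simps)
  then have tb: "t *\<^sub>R u \<in> ball 0 \<epsilon>" using t(1) eps by (simp add: distrib_left)
  have "t * ((norm (snd u))\<^sup>2 + 1) \<le> \<eta> * fst u" using t(4) pos by (simp add: field_simps)
  then have "t * (norm (snd u))\<^sup>2 \<le> \<eta> * fst u" using t(1) by (simp add: distrib_left)
  then have "t * (t * (norm (snd u))\<^sup>2) \<le> t * (\<eta> * fst u)" using t(1) by (intro mult_left_mono) auto
  moreover have "\<psi> (snd (t *\<^sub>R u)) \<le> t * (t * (norm (snd u))\<^sup>2) / (2 * \<eta>)"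
    using quadratic_bounds(2)[OF snd_in_ball[OF tb]] t(1)
    by (simp add: power_mult_distrib power2_eq_square mult_ac)
  ultimately have "\<psi> (snd (t *\<^sub>R u)) \<le> t * (\<eta> * fst u) / (2 * \<eta>)"
    using eta by (meson divide_right_mono order_trans less_imp_le mult_pos_pos zero_less_numeral)
  also have "\<dots> < t * fst u" using eta t(1) u(2) z by simp
  finally have "hmap x A (t *\<^sub>R z) \<in> D" using mem_D_iff[OF tb] AB by simp
  then show ?thesis using that t by fastforce
qed

lemma fst_pos_of_closure:
  assumes x: "x \<in> frontier D" and A: "A \<in> normal_isometries D x"
    and u: "hmap x A u \<in> closure D" "u \<noteq> 0"
  shows "0 < fst u"
proof -
  have "convexity * (norm u)\<^sup>2 \<le> fst u"
    using strong_support[OF x u(1)] inner_inward_normal[OF A, of u] normal_isometryD(2)[OF A, of u]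
    by (simp add: hmap_def)
  moreover have "0 < convexity * (norm u)\<^sup>2" using convexity_pos u(2) by simp
  ultimately show ?thesis by linarith
qed

text \<open>
  By strict support the closure of \<open>D\<close> meets the half space \<open>fst u \<le> 0\<close> only at the origin, so
  the segment to \<open>z\<close> never returns to \<open>\<partial>D\<close> and the stopped map falls back to its starting point.
\<close>
lemma gbar_origin_tangential:
  assumes x: "x \<in> frontier D" and A: "A \<in> normal_isometries D x"
    and z: "fst z \<le> 0"
  shows "gbar D x A 0 z = x"
proof (cases "z = 0")
  case True
  then show ?thesis using A x mem_frontier_D by (simp add: gbar_def Lam_def)
next
  case False
  have out: "hmap x A (\<theta> *\<^sub>R z) \<notin> closure D" if "0 < \<theta>" for \<theta>
    using fst_pos_of_closure[OF x A, of "\<theta> *\<^sub>R z"] that False z by (auto simp: zero_less_mult_iff)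
  have "ocsegment (hmap x A 0) (hmap x A z) \<inter> frontier D = {}"
  proof -
    have "p \<notin> frontier D" if "p \<in> ocsegment (hmap x A 0) (hmap x A z)" for p
      using that out mem_frontier_D unfolding mem_ocsegment_hmap[OF A] by fastforce
    then show ?thesis by blast
  qed
  then show ?thesis using out[of 1] A by (simp add: gbar_def Lam_def)
qed

text \<open>
  A starting point on the boundary is replaced by a nearby point of the segment that lies in
  \<open>D\<close>.
\<close>
lemma gbar_exit_from_origin:
  assumes x: "x \<in> frontier D" and A: "A \<in> normal_isometries D x"
    and z: "hmap x A z \<notin> D" "0 < fst z"
  obtains \<theta> where "0 < \<theta>" "\<theta> \<le> 1" "hmap x A (\<theta> *\<^sub>R z) \<in> frontier D" "gbar D x A 0 z = hmap x A (\<theta> *\<^sub>R z)"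
proof -
  obtain t where t: "0 < t" "t < 1" "hmap x A (t *\<^sub>R z) \<in> D" by (rule enters_domain[OF x A z(2)])
  obtain \<theta> where \<theta>: "0 < \<theta>" "\<theta> \<le> 1" "hmap x A (t *\<^sub>R z + \<theta> *\<^sub>R (z - t *\<^sub>R z)) \<in> frontier D"
    by (rule gbar_exit_from_inside[OF A t(3) z(1)])
  let ?\<tau> = "t + \<theta> * (1 - t)"
  have eq: "t *\<^sub>R z + \<theta> *\<^sub>R (z - t *\<^sub>R z) = ?\<tau> *\<^sub>R z" by (simp add: algebra_simps)
  have "0 < ?\<tau>" using t \<theta> by (simp add: add_pos_nonneg)
  moreover have "?\<tau> \<le> 1" 
  proof -
    have "t + \<theta> * (1 - t) \<le> t + (1 - t)"
      using t \<theta> by (intro add_left_mono mult_left_le_one_le) auto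
    also have "\<dots> = 1" by simp
    finally show ?thesis .
  qed
  moreover have "hmap x A (?\<tau> *\<^sub>R z) \<in> frontier D" using \<theta>(3) eq by simp
  moreover have "hmap x A 0 \<in> closure D" using A x mem_frontier_D by simp
  ultimately show ?thesis using that[of ?\<tau>] gbar_eq_exit_point[OF A _ z(1), of 0 ?\<tau>] by simp
qed

text \<open>
  In the statements with two exits the roles of the two copies are chosen according to which
  exit comes first. For a segment that starts at the origin, the sign of \<open>fst z\<close> decides for
  both copies at once whether it enters \<open>D\<close>, since both have the normal \<open>e1\<close>. If it does not,
  then both stopped points are the starting points and the difference is exactly \<open>x - x'\<close>.
\<close>
lemma boundary_comparison:
  assumes x: "x \<in> frontier D" and x': "x' \<in> frontier D"
    and A: "A \<in> normal_isometries D x" and A': "A' \<in> normal_isometries D x'"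
  shows "hmap x A y \<in> D \<Longrightarrow> hmap x' A' y \<in> D \<Longrightarrow> hmap x A z \<notin> D \<Longrightarrow> hmap x' A' z \<notin> D \<Longrightarrow>
     \<bar>norm (gbar D x A y z - gbar D x' A' y z) - norm (x - x')\<bar>
       \<le> lipschitz_const * rho x x' A A' * (min (norm z) 1 + norm y * min (norm (y - z)) 1
             / min (bdist D (hmap x A y)) (bdist D (hmap x' A' y)))" (is "PROP ?two_exits")
    and "hmap x A y \<in> D \<Longrightarrow> hmap x' A' y \<in> D \<Longrightarrow> hmap x A z \<notin> D \<Longrightarrow> hmap x' A' z \<in> D \<Longrightarrow>
     \<bar>norm (gbar D x A y z - hmap x' A' z) - norm (x - x')\<bar>
       \<le> lipschitz_const * rho x x' A A' * (min (norm z) 1 + norm y * min (norm (y - z)) 1 / bdist D (hmap x A y))"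
      (is "PROP ?one_exit")
    and "hmap x A z \<notin> D \<Longrightarrow> hmap x' A' z \<notin> D \<Longrightarrow>
     \<bar>norm (gbar D x A 0 z - gbar D x' A' 0 z) - norm (x - x')\<bar> \<le> lipschitz_const * rho x x' A A'"
      (is "PROP ?origin")
    and "\<bar>norm (gbar D x A 0 z - gbar D x' A' 0 z) - norm (x - x')\<bar> \<le> lipschitz_const" (is ?bounded)
proof -
  have fne: "frontier D \<noteq> {}" using x by blast
  have in_closure: "X \<in> closure D" if "X \<in> D \<or> X \<in> frontier D" for X
    using that mem_frontier_D closure_subset[of D] by blast
  show "PROP ?two_exits"
  proof -
    assume y: "hmap x A y \<in> D" "hmap x' A' y \<in> D" and z: "hmap x A z \<notin> D" "hmap x' A' z \<notin> D"
    let ?\<delta> = "min (bdist D (hmap x A y)) (bdist D (hmap x' A' y))"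
    obtain \<theta> where t: "0 < \<theta>" "\<theta> \<le> 1" "hmap x A (y + \<theta> *\<^sub>R (z - y)) \<in> frontier D"
      "gbar D x A y z = hmap x A (y + \<theta> *\<^sub>R (z - y))" by (rule gbar_exit_from_inside[OF A y(1) z(1)])
    obtain \<theta>' where t': "0 < \<theta>'" "\<theta>' \<le> 1" "hmap x' A' (y + \<theta>' *\<^sub>R (z - y)) \<in> frontier D"
      "gbar D x' A' y z = hmap x' A' (y + \<theta>' *\<^sub>R (z - y))" by (rule gbar_exit_from_inside[OF A' y(2) z(2)])
    have \<delta>: "0 < ?\<delta>" "?\<delta> \<le> bdist D (hmap x A y)" "?\<delta> \<le> bdist D (hmap x' A' y)"
      using bdist_pos[OF y(1) fne] bdist_pos[OF y(2) fne] by (simp_all only: min_less_iff_conj min.cobounded1 min.cobounded2)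
    show ?thesis
    proof (cases "\<theta> \<le> \<theta>'")
      case True
      show ?thesis
        using exit_comparison_from_inside[OF x x' A A' y(1) in_closure[OF disjI1[OF y(2)]] t(1) True t'(2) t(3)
            in_closure[OF disjI2[OF t'(3)]] \<delta>(1,2)]
        unfolding t(4) t'(4) .
    next
      case False
      then have "\<theta>' \<le> \<theta>" by simp
      from exit_comparison_from_inside[OF x' x A' A y(2) in_closure[OF disjI1[OF y(1)]] t'(1) this t(2) t'(3)
            in_closure[OF disjI2[OF t(3)]] \<delta>(1,3)]
      show ?thesis
        unfolding t(4) t'(4) rho_commute[of x' x A' A] norm_minus_commute[of "hmap x' _ _"]
          norm_minus_commute[of x' x] .
    qed
  qed
  show "PROP ?one_exit"
  proof -
    assume y: "hmap x A y \<in> D" "hmap x' A' y \<in> D" and z: "hmap x A z \<notin> D" "hmap x' A' z \<in> D"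
    obtain \<theta> where t: "0 < \<theta>" "\<theta> \<le> 1" "hmap x A (y + \<theta> *\<^sub>R (z - y)) \<in> frontier D"
      "gbar D x A y z = hmap x A (y + \<theta> *\<^sub>R (z - y))" by (rule gbar_exit_from_inside[OF A y(1) z(1)])
    have yz: "y + 1 *\<^sub>R (z - y) = z" by simp
    show ?thesis
      using exit_comparison_from_inside[OF x x' A A' y(1) in_closure[OF disjI1[OF y(2)]] t(1,2) order_refl t(3)
          _ bdist_pos[OF y(1) fne] order_refl, unfolded yz, OF in_closure[OF disjI1[OF z(2)]]]
      unfolding t(4) .
  qed
  show "PROP ?origin"
  proof -
    assume z: "hmap x A z \<notin> D" "hmap x' A' z \<notin> D"
    show ?thesis
    proof (cases "0 < fst z")
      case True
      obtain \<theta> where t: "0 < \<theta>" "\<theta> \<le> 1" "hmap x A (\<theta> *\<^sub>R z) \<in> frontier D"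
        "gbar D x A 0 z = hmap x A (\<theta> *\<^sub>R z)" by (rule gbar_exit_from_origin[OF x A z(1) True])
      obtain \<theta>' where t': "0 < \<theta>'" "\<theta>' \<le> 1" "hmap x' A' (\<theta>' *\<^sub>R z) \<in> frontier D"
        "gbar D x' A' 0 z = hmap x' A' (\<theta>' *\<^sub>R z)" by (rule gbar_exit_from_origin[OF x' A' z(2) True])
      show ?thesis
      proof (cases "\<theta> \<le> \<theta>'")
        case True
        show ?thesis
          using exit_comparison_from_origin[OF x x' A A' t(1) True t(3) in_closure[OF disjI2[OF t'(3)]]]
          unfolding t(4) t'(4) .
      next
        case False
        then have "\<theta>' \<le> \<theta>" by simp
        from exit_comparison_from_origin[OF x' x A' A t'(1) this t'(3) in_closure[OF disjI2[OF t(3)]]]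
        show ?thesis
          unfolding t(4) t'(4) rho_commute[of x' x A' A] norm_minus_commute[of "hmap x' _ _"]
            norm_minus_commute[of x' x] .
      qed
    next
      case False
      then have "fst z \<le> 0" by simp
      then show ?thesis
        using gbar_origin_tangential[OF x A] gbar_origin_tangential[OF x' A'] lipschitz_const_ge(3)
          rho_bounds(3)[OF A A'] by simp
    qed
  qed
  show ?bounded
  proof -
    have "gbar D x A 0 z \<in> closure D" "gbar D x' A' 0 z \<in> closure D"
      unfolding gbar_def hmap_zero[OF A] hmap_zero[OF A']
      by (rule Lam_in_closure[OF in_closure[OF disjI2[OF x]]]
          Lam_in_closure[OF in_closure[OF disjI2[OF x']]])+
    then have "norm (gbar D x A 0 z - gbar D x' A' 0 z) \<le> size_bound" by (rule size_bound(2))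
    moreover have "norm (x - x') \<le> size_bound" 
      by (rule size_bound(2)[OF in_closure[OF disjI2[OF x]] in_closure[OF disjI2[OF x']]])
    ultimately show ?thesis
      using lipschitz_const_ge(2) size_bound(1) norm_ge_zero[of "x - x'"]
        norm_ge_zero[of "gbar D x A 0 z - gbar D x' A' 0 z"] by linarith
  qed
qed

end

lemma strongly_convex_domain_of_C3:
  assumes "C3_strongly_convex D" "connected D"
  obtains \<epsilon> \<eta> where "strongly_convex_domain D \<epsilon> \<eta>"
proof -
  note C3 = assms(1)[unfolded C3_strongly_convex_def]
  have D: "open D" "bounded D"
    by (rule C3[THEN conjunct2, THEN conjunct1] C3[THEN conjunct2, THEN conjunct2, THEN conjunct1])+
  obtain \<epsilon> \<eta> where *: "0 < \<epsilon>" "\<epsilon> < 1" "0 < \<eta>" and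
    charts: "\<forall>x\<in>frontier D. \<exists>A\<in>normal_isometries D x. \<exists>\<psi> \<psi>1 \<psi>2 \<psi>3.
          C3_on_with (ball 0 \<epsilon>) \<psi> \<psi>1 \<psi>2 \<psi>3
          \<and> (\<forall>v\<in>ball 0 \<epsilon>. 0 \<le> \<psi> v)
          \<and> \<psi> 0 = 0 \<and> \<psi>1 0 = 0
          \<and> (\<forall>v\<in>ball 0 \<epsilon>. \<forall>w. \<eta> * (norm w)\<^sup>2 \<le> blinfun_apply (blinfun_apply (\<psi>2 v) w) w)
          \<and> (\<forall>v\<in>ball 0 \<epsilon>. norm (\<psi>2 v) + norm (\<psi>3 v) \<le> 1 / \<eta>)
          \<and> D \<inter> ball x \<epsilon> = {hmap x A u | u. u \<in> ball 0 \<epsilon> \<and> fst u > \<psi> (snd u)}"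
    using C3[THEN conjunct2, THEN conjunct2, THEN conjunct2] by (elim exE conjE)
  have "strongly_convex_domain D \<epsilon> \<eta>"
  proof
    fix x assume x: "x \<in> frontier D"
    from bspec[OF charts x] obtain A \<psi> \<psi>1 \<psi>2 \<psi>3 where c: "A \<in> normal_isometries D x"
      "C3_on_with (ball 0 \<epsilon>) \<psi> \<psi>1 \<psi>2 \<psi>3" "\<psi> 0 = 0" "\<psi>1 0 = 0"
      "\<forall>v\<in>ball 0 \<epsilon>. \<forall>w. \<eta> * (norm w)\<^sup>2 \<le> blinfun_apply (blinfun_apply (\<psi>2 v) w) w"
      "\<forall>v\<in>ball 0 \<epsilon>. norm (\<psi>2 v) + norm (\<psi>3 v) \<le> 1 / \<eta>"
      "D \<inter> ball x \<epsilon> = {hmap x A u | u. u \<in> ball 0 \<epsilon> \<and> fst u > \<psi> (snd u)}"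
      by (elim bexE exE conjE)
    have "boundary_chart D \<epsilon> \<eta> x A \<psi> \<psi>1 \<psi>2 \<psi>3"
      by (rule boundary_chart.intro[OF D(1) * c(1-4) bspec[OF c(5), THEN spec] bspec[OF c(6)] c(7)])
    then show "\<exists>A \<psi> \<psi>1 \<psi>2 \<psi>3. boundary_chart D \<epsilon> \<eta> x A \<psi> \<psi>1 \<psi>2 \<psi>3" by blast
  qed (rule * D assms(2))+
  then show ?thesis using that by blast
qed

theorem proposition39:
  fixes D :: "(real \<times> (real ^ 'n)) set"
  assumes "C3_strongly_convex D" and "connected D"
  shows "\<exists>C>0. \<forall>x\<in>frontier D. \<forall>x'\<in>frontier D.
    \<forall>A\<in>normal_isometries D x. \<forall>A'\<in>normal_isometries D x'.
      (\<forall>y z. hmap x A y \<in> D \<longrightarrow> hmap x' A' y \<in> D \<longrightarrow> hmap x A z \<notin> D \<longrightarrow> hmap x' A' z \<notin> D \<longrightarrow>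
         \<bar>norm (gbar D x A y z - gbar D x' A' y z) - norm (x - x')\<bar>
           \<le> C * rho x x' A A' *
              (min (norm z) 1 + norm y * min (norm (y - z)) 1
                 / min (bdist D (hmap x A y)) (bdist D (hmap x' A' y))))
    \<and> (\<forall>y z. hmap x A y \<in> D \<longrightarrow> hmap x' A' y \<in> D \<longrightarrow> hmap x A z \<notin> D \<longrightarrow> hmap x' A' z \<in> D \<longrightarrow>
         \<bar>norm (gbar D x A y z - hmap x' A' z) - norm (x - x')\<bar>
           \<le> C * rho x x' A A' *
              (min (norm z) 1 + norm y * min (norm (y - z)) 1 / bdist D (hmap x A y)))
    \<and> (\<forall>z. hmap x A z \<notin> D \<longrightarrow> hmap x' A' z \<notin> D \<longrightarrow>
         \<bar>norm (gbar D x A 0 z - gbar D x' A' 0 z) - norm (x - x')\<bar> \<le> C * rho x x' A A')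
    \<and> (\<forall>z. \<bar>norm (gbar D x A 0 z - gbar D x' A' 0 z) - norm (x - x')\<bar> \<le> C)"
proof -
  obtain \<epsilon> \<eta> where "strongly_convex_domain D \<epsilon> \<eta>"
    by (rule strongly_convex_domain_of_C3[OF assms])
  then interpret strongly_convex_domain D \<epsilon> \<eta> .
  show ?thesis
  proof (intro exI[of _ lipschitz_const] conjI ballI allI impI)
    show "0 < lipschitz_const" by (rule lipschitz_const_ge(3))
  qed (rule boundary_comparison; assumption)+
qed

end
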